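(* Let $R$ be a characteristic range set and let $X$ be an ultrametrizable topological space. Then $X$ is $\sigma$-compact if and only if the space $(\mathrm{UMet}_{\mathrm{bd}}(X;R),\mathcal{UD}_X^R)$ is completely metrizable.
   Context: A range set is a subset $R\subseteq[0,\infty)$ with $0\in R$; it is characteristic if $\inf(R\setminus\{0\})=0$. A pseudo-ultrametric on a set $X$ is a symmetric map $d\colon X\times X\to[0,\infty)$ vanishing on the diagonal with $d(x,y)\leq d(x,z)\vee d(z,y)$ for all $x,y,z$, where $a\vee b=\max\{a,b\}$; it is an ultrametric if moreover $d(x,y)=0$ implies $x=y$. It is $R$-valued if all its values lie in $R$. A topological space is ultrametrizable if its topology is generated by some ultrametric, and $\sigma$-compact if it is a countable union of compact subsets. For a topological space $X$, $\mathrm{UMet}_{\mathrm{bd}}(X;R)$ denotes the set of all bounded $R$-valued ultrametrics on $X$ that generate the topology of $X$. For $R$-valued pseudo-ultrametrics $d,e$ on $X$, $$\mathcal{UD}_X^R(d,e)=\inf\bigl\{\epsilon\in R\setminus\{0\} : d(x,y)\leq e(x,y)\vee\epsilon\ \text{and}\ e(x,y)\leq d(x,y)\vee\epsilon\ \text{for all } x,y\in X\bigr\},$$ with $\inf\emptyset=\infty$. This is an extended ultrametric (values in $[0,\infty]$), and $\mathrm{UMet}_{\mathrm{bd}}(X;R)$ is given the metrizable topology generated by its $\epsilon$-balls; complete metrizability refers to this topology. *)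

theory Defs
  imports "HOL-Analysis.Analysis"
begin

definition range_set :: "real set \<Rightarrow> bool" where
  "range_set R \<longleftrightarrow> R \<subseteq> {0..} \<and> 0 \<in> R"

text \<open>The infimum is taken in \<open>[0,\<infinity>]\<close>, so that \<open>R = {0}\<close>, with \<open>inf \<emptyset> = \<infinity>\<close>, is not characteristic;
  on type \<^typ>\<open>real\<close> the infimum of the empty set has no such meaning.\<close>

definition characteristic_range_set :: "real set \<Rightarrow> bool" where
  "characteristic_range_set R \<longleftrightarrow> range_set R \<and> (INF r\<in>R - {0}. ennreal r) = 0"

text \<open>A map \<open>S \<times> S \<rightarrow> [0,\<infinity>)\<close> is represented by the total function extending it by \<open>0\<close>, as required in
  the last clause. So equality of representatives is equality on \<open>S \<times> S\<close>, and the conditions that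
  the locale \<^locale>\<open>Metric_space\<close> imposes outside the carrier (nonnegativity, symmetry) hold.\<close>

definition pseudo_ultrametric_on :: "'a set \<Rightarrow> ('a \<Rightarrow> 'a \<Rightarrow> real) \<Rightarrow> bool" where
  "pseudo_ultrametric_on S d \<longleftrightarrow>
     (\<forall>x\<in>S. \<forall>y\<in>S. 0 \<le> d x y) \<and>
     (\<forall>x\<in>S. \<forall>y\<in>S. d x y = d y x) \<and>
     (\<forall>x\<in>S. d x x = 0) \<and>
     (\<forall>x\<in>S. \<forall>y\<in>S. \<forall>z\<in>S. d x y \<le> max (d x z) (d z y)) \<and>
     (\<forall>x y. x \<notin> S \<or> y \<notin> S \<longrightarrow> d x y = 0)"

definition ultrametric_on :: "'a set \<Rightarrow> ('a \<Rightarrow> 'a \<Rightarrow> real) \<Rightarrow> bool" where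
  "ultrametric_on S d \<longleftrightarrow>
     pseudo_ultrametric_on S d \<and> (\<forall>x\<in>S. \<forall>y\<in>S. d x y = 0 \<longrightarrow> x = y)"

lemma ultrametric_on_Metric_space:
  assumes "ultrametric_on S d"
  shows "Metric_space S d"
proof
  fix x y
  show "0 \<le> d x y" "d x y = d y x"
    using assms unfolding ultrametric_on_def pseudo_ultrametric_on_def by (metis order_refl)+
next
  fix x y assume "x \<in> S" "y \<in> S"
  then show "d x y = 0 \<longleftrightarrow> x = y"
    using assms unfolding ultrametric_on_def pseudo_ultrametric_on_def by metis
next
  fix x y z assume "x \<in> S" "y \<in> S" "z \<in> S"
  then have "d x z \<le> max (d x y) (d y z)" "0 \<le> d x y" "0 \<le> d y z"
    using assms unfolding ultrametric_on_def pseudo_ultrametric_on_def by metis+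
  then show "d x z \<le> d x y + d y z" by linarith
qed

text \<open>\<^const>\<open>Metric_space.mtopology\<close> is the usual metric topology only for arguments satisfying
  \<^locale>\<open>Metric_space\<close>; below it is always guarded by \<^const>\<open>ultrametric_on\<close>.\<close>

definition ultrametrizable_space :: "'a topology \<Rightarrow> bool" where
  "ultrametrizable_space X \<longleftrightarrow>
     (\<exists>d. ultrametric_on (topspace X) d \<and> Metric_space.mtopology (topspace X) d = X)"

definition sigma_compact_space :: "'a topology \<Rightarrow> bool" where
  "sigma_compact_space X \<longleftrightarrow>
     (\<exists>\<K>. countable \<K> \<and> (\<forall>K\<in>\<K>. compactin X K) \<and> \<Union>\<K> = topspace X)"

definition UMet_bd :: "'a topology \<Rightarrow> real set \<Rightarrow> ('a \<Rightarrow> 'a \<Rightarrow> real) set" where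
  "UMet_bd X R =
     {d. ultrametric_on (topspace X) d \<and>
         (\<forall>x\<in>topspace X. \<forall>y\<in>topspace X. d x y \<in> R) \<and>
         (\<exists>B. \<forall>x\<in>topspace X. \<forall>y\<in>topspace X. d x y \<le> B) \<and>
         Metric_space.mtopology (topspace X) d = X}"

definition UD :: "'a set \<Rightarrow> real set \<Rightarrow> ('a \<Rightarrow> 'a \<Rightarrow> real) \<Rightarrow> ('a \<Rightarrow> 'a \<Rightarrow> real) \<Rightarrow> ennreal" where
  "UD S R d e =
     (INF \<epsilon>\<in>{\<epsilon>\<in>R - {0}. \<forall>x\<in>S. \<forall>y\<in>S. d x y \<le> max (e x y) \<epsilon> \<and> e x y \<le> max (d x y) \<epsilon>}. ennreal \<epsilon>)"

definition UMet_bd_topology ::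
  "'a topology \<Rightarrow> real set \<Rightarrow> ('a \<Rightarrow> 'a \<Rightarrow> real) topology" where
  "UMet_bd_topology X R =
     topology_generated_by
       {{e \<in> UMet_bd X R. UD (topspace X) R d e < ennreal \<epsilon>} | d \<epsilon>. d \<in> UMet_bd X R \<and> 0 < \<epsilon>}"

lemma topspace_UMet_bd_topology:
  assumes "characteristic_range_set R"
  shows "topspace (UMet_bd_topology X R) = UMet_bd X R"
proof -
  have "UD (topspace X) R d d = 0" for d
    using assms by (simp add: UD_def characteristic_range_set_def set_diff_eq)
  then have ball: "d \<in> {e \<in> UMet_bd X R. UD (topspace X) R d e < ennreal 1}"
    if "d \<in> UMet_bd X R" for d
    using that by simp
  show ?thesis
    unfolding UMet_bd_topology_def topology_generated_by_topspace
  proof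
    show "UMet_bd X R \<subseteq> \<Union>{{e \<in> UMet_bd X R. UD (topspace X) R d e < ennreal \<epsilon>} | d \<epsilon>.
        d \<in> UMet_bd X R \<and> 0 < \<epsilon>}"
    proof
      fix d assume d: "d \<in> UMet_bd X R"
      have "{e \<in> UMet_bd X R. UD (topspace X) R d e < ennreal 1} \<in>
          {{e \<in> UMet_bd X R. UD (topspace X) R d e < ennreal \<epsilon>} | d \<epsilon>.
            d \<in> UMet_bd X R \<and> 0 < \<epsilon>}"
        using d zero_less_one by blast
      with ball[OF d] show "d \<in> \<Union>{{e \<in> UMet_bd X R. UD (topspace X) R d e < ennreal \<epsilon>} | d \<epsilon>.
          d \<in> UMet_bd X R \<and> 0 < \<epsilon>}"
        by (rule UnionI[rotated])
    qed
  qed auto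
qed

end

theory Submission
  imports Defs
begin

text \<open>The bounded continuous \<open>R\<close>-valued pseudo-ultrametrics form a complete space. For compact \<open>K\<close> and
  \<open>\<epsilon> > 0\<close>, those \<open>d\<close> for which some \<open>\<delta> > 0\<close> makes \<open>d(x,y) < \<delta>\<close> imply \<open>D(x,y) < \<epsilon>\<close> for all
  \<open>x \<in> K\<close> form an open set, where \<open>D\<close> is a fixed ultrametric generating the topology. If \<open>X\<close> is
  \<open>\<sigma>\<close>-compact, countably many of these sets intersect in the generating ultrametrics.

  Conversely, suppose the space of ultrametrics is completely metrizable and \<open>X\<close> is not compact, so that some
  locally constant \<open>g : X \<rightarrow> \<nat>\<close> is unbounded. In a variant of the Menger game, player ONE plays
  locally constant functions \<open>f\<^sub>n \<ge> g\<close>, player TWO answers with bounds \<open>k\<^sub>n\<close>, and TWO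
  wins if every \<open>x\<close> satisfies \<open>f\<^sub>n x < k\<^sub>n\<close> for some \<open>n\<close>. ONE's moves are coded by
  perturbing an ultrametric at ever smaller scales so that the sets \<open>{f\<^sub>n \<ge> k}\<close> shrink; TWO chooses \<open>k\<^sub>n\<close> so
  that the resulting sequence converges for the complete metric. As the limit generates the topology,
  TWO wins. An argument of Telgarsky then applies: in each position the points covered by TWO's answers to all
  moves form a set on which all locally constant functions are bounded, hence a compact set, and if \<open>X\<close> is
  Lindelof, countably many positions suffice. Separability of \<open>X\<close> comes from the same game, played with
  functions taken from an Ulam matrix on an uncountable set of balls of equal radius.\<close>

section \<open>The space of ultrametrics as a \<open>G\<^sub>\<delta>\<close> set\<close>

text \<open>The condition in the infimum of \<open>UD\<close> at a fixed threshold. Since the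
  maximum absorbs errors, it is an equivalence relation for each \<delta>, with no loss in
  transitivity.\<close>

definition near :: "'a set \<Rightarrow> real \<Rightarrow> ('a \<Rightarrow> 'a \<Rightarrow> real) \<Rightarrow> ('a \<Rightarrow> 'a \<Rightarrow> real) \<Rightarrow> bool" where
  "near S \<delta> d e \<longleftrightarrow> (\<forall>x\<in>S. \<forall>y\<in>S. d x y \<le> max (e x y) \<delta> \<and> e x y \<le> max (d x y) \<delta>)"

text \<open>Here \<delta> may depend on \<open>x\<close>: this is continuity of the identity map,
  not uniform continuity. Compactness bridges the gap between the two.\<close>

definition finer_on :: "'a set \<Rightarrow> ('a \<Rightarrow> 'a \<Rightarrow> real) \<Rightarrow> ('a \<Rightarrow> 'a \<Rightarrow> real) \<Rightarrow> bool" where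
  "finer_on S d e \<longleftrightarrow> (\<forall>x\<in>S. \<forall>\<epsilon>>0. \<exists>\<delta>>0. \<forall>y\<in>S. d x y < \<delta> \<longrightarrow> e x y < \<epsilon>)"

lemma near_refl: "near S \<delta> d d"
  by (simp add: near_def)

lemma near_sym: "near S \<delta> d e \<Longrightarrow> near S \<delta> e d"
  by (auto simp: near_def)

lemma near_trans: "near S \<delta> d e \<Longrightarrow> near S \<delta> e f \<Longrightarrow> near S \<delta> d f"
  unfolding near_def by (smt (verit) max_def)

lemma near_mono: "near S \<delta> d e \<Longrightarrow> \<delta> \<le> \<delta>' \<Longrightarrow> near S \<delta>' d e"
  unfolding near_def by (smt (verit) max_def)

lemma nearD:
  assumes "near S \<delta> d e" "x \<in> S" "y \<in> S"
  shows "d x y \<le> max (e x y) \<delta>" "e x y \<le> max (d x y) \<delta>"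
  using assms by (auto simp: near_def)

lemma near_less:
  assumes "near S \<delta> d e" "x \<in> S" "y \<in> S" "d x y < \<epsilon>" "\<delta> < \<epsilon>"
  shows "e x y < \<epsilon>"
  using nearD(2)[OF assms(1-3)] assms(4,5) by linarith

text \<open>The first three facts hold off \<open>S\<close> as well, because \<open>d\<close> is
  extended by 0.\<close>

lemma pseudo_ultrametric_onD:
  assumes "pseudo_ultrametric_on S d"
  shows "0 \<le> d x y" "d x y = d y x" "d x x = 0"
    and "x \<in> S \<Longrightarrow> y \<in> S \<Longrightarrow> z \<in> S \<Longrightarrow> d x y \<le> max (d x z) (d z y)"
    and "x \<notin> S \<or> y \<notin> S \<Longrightarrow> d x y = 0"
  using assms unfolding pseudo_ultrametric_on_def by (metis order_refl)+

lemma pseudo_ultrametric_on_less: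
  assumes "pseudo_ultrametric_on S d" "x \<in> S" "y \<in> S" "z \<in> S" "d x z < \<epsilon>" "d z y < \<epsilon>"
  shows "d x y < \<epsilon>"
  using pseudo_ultrametric_onD(4)[OF assms(1-4)] assms(5,6) by linarith

lemma pseudo_ultrametric_on_eqI:
  assumes "pseudo_ultrametric_on S d" "pseudo_ultrametric_on S e"
    and "\<And>x y. x \<in> S \<Longrightarrow> y \<in> S \<Longrightarrow> d x y = e x y"
  shows "d = e"
proof (intro ext)
  fix x y
  show "d x y = e x y"
    using assms(3)[of x y] pseudo_ultrametric_onD(5)[OF assms(1), of x y]
      pseudo_ultrametric_onD(5)[OF assms(2), of x y] by metis
qed

section \<open>The topology of \<open>UD\<close> in terms of nearness\<close>

lemma characteristic_range_setD:
  assumes "characteristic_range_set R"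
  shows "R \<subseteq> {0..}" "0 \<in> R" and "0 < \<epsilon> \<Longrightarrow> \<exists>r\<in>R - {0}. 0 < r \<and> r < \<epsilon>"
proof -
  show R: "R \<subseteq> {0..}" "0 \<in> R"
    using assms by (auto simp: characteristic_range_set_def range_set_def)
  assume "0 < \<epsilon>"
  then have "(INF r\<in>R - {0}. ennreal r) < ennreal \<epsilon>"
    using assms by (simp add: characteristic_range_set_def)
  then obtain r where r: "r \<in> R - {0}" "ennreal r < ennreal \<epsilon>"
    by (auto simp: INF_less_iff)
  moreover from r R have "0 < r" by force
  ultimately show "\<exists>r\<in>R - {0}. 0 < r \<and> r < \<epsilon>"
    by (auto simp: ennreal_less_iff)
qed

text \<open>An infimum lies strictly below a bound exactly when a member does, and on nonnegative
  numbers \<open>ennreal\<close> preserves and reflects the strict order.\<close>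

lemma UD_less_iff:
  assumes "R \<subseteq> {0..}"
  shows "UD S R d e < ennreal \<epsilon> \<longleftrightarrow> (\<exists>\<delta>\<in>R - {0}. \<delta> < \<epsilon> \<and> near S \<delta> d e)"
proof -
  have "0 \<le> \<delta>" if "\<delta> \<in> R" for \<delta>
    using that assms by auto
  then show ?thesis
    unfolding UD_def INF_less_iff near_def by (auto simp: ennreal_less_iff)
qed

text \<open>By transitivity of \<open>near\<close> a ball is a neighbourhood of each of its points
  with unchanged threshold, and the smaller of two thresholds serves an intersection. So the balls,
  given only as a subbase, yield the usual description of open sets.\<close>

lemma openin_UMet_bd_topology:
  assumes R: "characteristic_range_set R"
  shows "openin (UMet_bd_topology X R) U \<longleftrightarrow>
    U \<subseteq> UMet_bd X R \<and>
    (\<forall>d\<in>U. \<exists>\<delta>\<in>R - {0}. \<forall>e\<in>UMet_bd X R. near (topspace X) \<delta> d e \<longrightarrow> e \<in> U)"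
    (is "_ \<longleftrightarrow> ?rhs U")
proof
  let ?\<S> = "{{e \<in> UMet_bd X R. UD (topspace X) R d e < ennreal \<epsilon>} | d \<epsilon>. d \<in> UMet_bd X R \<and> 0 < \<epsilon>}"
  note UD = UD_less_iff[OF characteristic_range_setD(1)[OF R]]
  show "?rhs U" if "openin (UMet_bd_topology X R) U"
  proof -
    from that have "generate_topology_on ?\<S> U"
      by (simp only: UMet_bd_topology_def openin_topology_generated_by_iff)
    then show ?thesis
    proof induction
      case Empty
      then show ?case by simp
    next
      case (Int a b)
      show ?case
      proof (intro conjI ballI)
        show "a \<inter> b \<subseteq> UMet_bd X R"
          using Int.IH by blast
        fix d assume d: "d \<in> a \<inter> b"
        then obtain \<delta> \<delta>' where \<delta>: "\<delta> \<in> R - {0}" "\<delta>' \<in> R - {0}"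
          "\<forall>e\<in>UMet_bd X R. near (topspace X) \<delta> d e \<longrightarrow> e \<in> a"
          "\<forall>e\<in>UMet_bd X R. near (topspace X) \<delta>' d e \<longrightarrow> e \<in> b"
          using Int.IH by blast
        have "min \<delta> \<delta>' \<in> R - {0}"
          using \<delta>(1,2) by (simp add: min_def)
        moreover have "\<forall>e\<in>UMet_bd X R. near (topspace X) (min \<delta> \<delta>') d e \<longrightarrow> e \<in> a \<inter> b"
          using \<delta>(3,4) near_mono[OF _ min.cobounded1] near_mono[OF _ min.cobounded2] by blast
        ultimately show "\<exists>\<delta>\<in>R - {0}. \<forall>e\<in>UMet_bd X R. near (topspace X) \<delta> d e \<longrightarrow> e \<in> a \<inter> b" ..
      qed
    next
      case (UN K)
      then show ?case by (meson Union_iff Union_least)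
    next
      case (Basis s)
      then obtain d \<epsilon> where s: "s = {e \<in> UMet_bd X R. UD (topspace X) R d e < ennreal \<epsilon>}"
        by blast
      show ?case
      proof (intro conjI ballI)
        show "s \<subseteq> UMet_bd X R" using s by auto
        fix e assume "e \<in> s"
        then obtain \<delta> where "\<delta> \<in> R - {0}" "\<delta> < \<epsilon>" "near (topspace X) \<delta> d e"
          by (auto simp: s UD)
        then show "\<exists>\<delta>\<in>R - {0}. \<forall>f\<in>UMet_bd X R. near (topspace X) \<delta> e f \<longrightarrow> f \<in> s"
          using near_trans unfolding s UD mem_Collect_eq by blast
      qed
    qed
  qed
  show "openin (UMet_bd_topology X R) U" if U: "?rhs U"
  proof (subst openin_subopen, intro ballI)
    fix d assume d: "d \<in> U"
    with U obtain \<delta> where \<delta>: "\<delta> \<in> R - {0}"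
      and sub: "\<And>e. e \<in> UMet_bd X R \<Longrightarrow> near (topspace X) \<delta> d e \<Longrightarrow> e \<in> U"
      by blast
    have pos: "0 < \<delta>"
      using characteristic_range_setD(1)[OF R] \<delta> by force
    have dU: "d \<in> UMet_bd X R" using d U by blast
    let ?B = "{e \<in> UMet_bd X R. UD (topspace X) R d e < ennreal \<delta>}"
    have "openin (UMet_bd_topology X R) ?B"
      unfolding UMet_bd_topology_def
      by (rule topology_generated_by_Basis) (use dU pos in blast)
    moreover have "d \<in> ?B"
      using dU characteristic_range_setD(3)[OF R pos] near_refl by (auto simp: UD)
    moreover have "?B \<subseteq> U"
      using sub near_mono by (fastforce simp: UD)
    ultimately show "\<exists>T. openin (UMet_bd_topology X R) T \<and> d \<in> T \<and> T \<subseteq> U"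
      by blast
  qed
qed

section \<open>Comparing the topologies of two metrics\<close>

lemma mtopology_le_iff_finer_on:
  assumes "Metric_space S d" "Metric_space S e"
  shows "(\<forall>U. openin (Metric_space.mtopology S e) U \<longrightarrow> openin (Metric_space.mtopology S d) U)
    \<longleftrightarrow> finer_on S d e"
proof -
  interpret d: Metric_space S d by fact
  interpret e: Metric_space S e by fact
  show ?thesis
  proof
    assume le: "\<forall>U. openin e.mtopology U \<longrightarrow> openin d.mtopology U"
    show "finer_on S d e"
      unfolding finer_on_def
    proof (intro ballI allI impI)
      fix x and \<epsilon> :: real assume x: "x \<in> S" and "0 < \<epsilon>"
      then obtain \<delta> where "\<delta> > 0" "d.mball x \<delta> \<subseteq> e.mball x \<epsilon>"
        using le e.openin_mball[of x \<epsilon>] e.centre_in_mball_iff[of x \<epsilon>] d.openin_mtopology by meson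
      then show "\<exists>\<delta>>0. \<forall>y\<in>S. d x y < \<delta> \<longrightarrow> e x y < \<epsilon>"
        using x by (intro exI[of _ \<delta>]) (auto simp: d.mball_def e.mball_def)
    qed
  next
    assume fin: "finer_on S d e"
    show "\<forall>U. openin e.mtopology U \<longrightarrow> openin d.mtopology U"
      unfolding d.openin_mtopology e.openin_mtopology
    proof (intro allI impI conjI)
      fix U x assume U: "U \<subseteq> S \<and> (\<forall>x. x \<in> U \<longrightarrow> (\<exists>r>0. e.mball x r \<subseteq> U))" and x: "x \<in> U"
      then obtain r where r: "r > 0" "e.mball x r \<subseteq> U" by blast
      moreover have "x \<in> S" using x U by auto
      ultimately obtain \<delta> where "\<delta> > 0" "\<forall>y\<in>S. d x y < \<delta> \<longrightarrow> e x y < r"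
        using fin unfolding finer_on_def by meson
      with r show "\<exists>r>0. d.mball x r \<subseteq> U"
        by (intro exI[of _ \<delta>]) (auto simp: d.mball_def e.mball_def)
    qed auto
  qed
qed

lemma mtopology_eq_iff_finer_on:
  assumes "Metric_space S d" "Metric_space S e"
  shows "Metric_space.mtopology S d = Metric_space.mtopology S e \<longleftrightarrow> finer_on S d e \<and> finer_on S e d"
  using mtopology_le_iff_finer_on[OF assms] mtopology_le_iff_finer_on[OF assms(2,1)]
  unfolding topology_eq by blast

lemma mem_UMet_bd_iff:
  assumes "ultrametric_on (topspace X) D" "Metric_space.mtopology (topspace X) D = X"
  shows "d \<in> UMet_bd X R \<longleftrightarrow>
    ultrametric_on (topspace X) d \<and>
    (\<forall>x\<in>topspace X. \<forall>y\<in>topspace X. d x y \<in> R) \<and>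
    (\<exists>B. \<forall>x\<in>topspace X. \<forall>y\<in>topspace X. d x y \<le> B) \<and>
    finer_on (topspace X) D d \<and> finer_on (topspace X) d D"
proof -
  have "Metric_space.mtopology (topspace X) d = X \<longleftrightarrow>
      finer_on (topspace X) D d \<and> finer_on (topspace X) d D" if "ultrametric_on (topspace X) d"
    using mtopology_eq_iff_finer_on[OF that[THEN ultrametric_on_Metric_space]
        assms(1)[THEN ultrametric_on_Metric_space]] assms(2) by auto
  then show ?thesis
    unfolding UMet_bd_def mem_Collect_eq by blast
qed

section \<open>A complete metric on the continuous pseudo-ultrametrics\<close>

definition near_dist :: "'a set \<Rightarrow> ('a \<Rightarrow> 'a \<Rightarrow> real) \<Rightarrow> ('a \<Rightarrow> 'a \<Rightarrow> real) \<Rightarrow> real" where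
  "near_dist S d e = Inf {\<delta>. 0 \<le> \<delta> \<and> near S \<delta> d e}"

text \<open>The completion of the space of ultrametrics: continuity is kept, separation is dropped.\<close>

definition continuous_pums ::
  "'a set \<Rightarrow> real set \<Rightarrow> ('a \<Rightarrow> 'a \<Rightarrow> real) \<Rightarrow> ('a \<Rightarrow> 'a \<Rightarrow> real) set" where
  "continuous_pums S R D =
     {d. pseudo_ultrametric_on S d \<and>
         (\<forall>x\<in>S. \<forall>y\<in>S. d x y \<in> R) \<and>
         (\<exists>B. \<forall>x\<in>S. \<forall>y\<in>S. d x y \<le> B) \<and>
         finer_on S D d}"

lemma continuous_pumsD:
  assumes "d \<in> continuous_pums S R D"
  shows "pseudo_ultrametric_on S d" "x \<in> S \<Longrightarrow> y \<in> S \<Longrightarrow> d x y \<in> R"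
    "\<exists>B. \<forall>x\<in>S. \<forall>y\<in>S. d x y \<le> B" "finer_on S D d"
  using assms by (auto simp: continuous_pums_def)

lemma near_dist_commute: "near_dist S d e = near_dist S e d"
proof -
  have "near S \<delta> d e \<longleftrightarrow> near S \<delta> e d" for \<delta>
    by (metis near_sym)
  then show ?thesis
    by (simp add: near_dist_def)
qed

text \<open>Boundedness of \<open>d\<close> and \<open>e\<close> makes the set of thresholds
  nonempty, so the real \<open>Inf\<close> is genuine. Unlike in \<open>UD\<close>, thresholds range
  over all nonnegative reals.\<close>

lemma near_dist_less_iff:
  assumes "d \<in> continuous_pums S R D" "e \<in> continuous_pums S R D"
  shows "near_dist S d e < \<epsilon> \<longleftrightarrow> (\<exists>\<delta>\<ge>0. \<delta> < \<epsilon> \<and> near S \<delta> d e)"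
proof -
  obtain B B' where "\<forall>x\<in>S. \<forall>y\<in>S. d x y \<le> B" "\<forall>x\<in>S. \<forall>y\<in>S. e x y \<le> B'"
    using continuous_pumsD(3)[OF assms(1)] continuous_pumsD(3)[OF assms(2)] by blast
  then have "near S (max 0 (max B B')) d e"
    by (simp add: near_def le_max_iff_disj)
  then have "{\<delta>. 0 \<le> \<delta> \<and> near S \<delta> d e} \<noteq> {}"
    by (metis (mono_tags, lifting) empty_iff max.cobounded1 mem_Collect_eq)
  moreover have "bdd_below {\<delta>. 0 \<le> \<delta> \<and> near S \<delta> d e}"
    by (auto intro: bdd_belowI)
  ultimately show ?thesis
    unfolding near_dist_def by (auto simp: cInf_less_iff)
qed

lemma near_dist_nonneg:
  assumes "d \<in> continuous_pums S R D" "e \<in> continuous_pums S R D"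
  shows "0 \<le> near_dist S d e"
  using near_dist_less_iff[OF assms, of 0] by linarith

lemma near_dist_less_imp_near:
  assumes "d \<in> continuous_pums S R D" "e \<in> continuous_pums S R D" "near_dist S d e < \<epsilon>"
  shows "near S \<epsilon> d e"
  using near_dist_less_iff[OF assms(1,2), of \<epsilon>] assms(3) near_mono by (meson less_imp_le)

lemma near_imp_near_dist_le:
  assumes "d \<in> continuous_pums S R D" "e \<in> continuous_pums S R D" "near S \<delta> d e" "0 \<le> \<delta>"
  shows "near_dist S d e \<le> \<delta>"
proof (rule dense_ge)
  fix \<epsilon> assume "\<delta> < \<epsilon>"
  then show "near_dist S d e \<le> \<epsilon>"
    using near_dist_less_iff[OF assms(1,2), of \<epsilon>] assms(3,4) by (blast intro: less_imp_le)
qed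

text \<open>Outside the carrier the infimum may be junk, so the metric is cut off there.\<close>

definition pum_dist ::
  "'a set \<Rightarrow> real set \<Rightarrow> ('a \<Rightarrow> 'a \<Rightarrow> real) \<Rightarrow> ('a \<Rightarrow> 'a \<Rightarrow> real) \<Rightarrow> ('a \<Rightarrow> 'a \<Rightarrow> real) \<Rightarrow> real" where
  "pum_dist S R D d e =
     (if d \<in> continuous_pums S R D \<and> e \<in> continuous_pums S R D then near_dist S d e else 0)"

lemma Metric_space_pum_dist: "Metric_space (continuous_pums S R D) (pum_dist S R D)"
proof
  fix d e
  show "0 \<le> pum_dist S R D d e"
    by (auto simp: pum_dist_def near_dist_nonneg)
  show "pum_dist S R D d e = pum_dist S R D e d"
    by (simp add: pum_dist_def near_dist_commute)
next
  let ?M = "continuous_pums S R D"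
  fix d e assume d: "d \<in> ?M" and e: "e \<in> ?M"
  show "pum_dist S R D d e = 0 \<longleftrightarrow> d = e"
  proof
    assume "pum_dist S R D d e = 0"
    then have near: "near S \<epsilon> d e" if "\<epsilon> > 0" for \<epsilon>
      using near_dist_less_imp_near[OF d e] that d e by (simp add: pum_dist_def)
    show "d = e"
    proof (rule pseudo_ultrametric_on_eqI)
      show "pseudo_ultrametric_on S d" "pseudo_ultrametric_on S e"
        using d e continuous_pumsD(1) by auto
      fix x y assume "x \<in> S" "y \<in> S"
      then have le: "d x y \<le> max (e x y) \<epsilon>" "e x y \<le> max (d x y) \<epsilon>" if "\<epsilon> > 0" for \<epsilon>
        using nearD[OF near[OF that]] by auto
      have "0 \<le> d x y" "0 \<le> e x y"
        using pseudo_ultrametric_onD(1)[OF continuous_pumsD(1)[OF d]]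
          pseudo_ultrametric_onD(1)[OF continuous_pumsD(1)[OF e]] by auto
      \<comment> \<open>If \<open>d x y\<close> is positive, the threshold \<open>d x y / 2\<close>
        cannot realise the maximum, so \<open>d x y \<le> e x y\<close>; likewise with the roles
        exchanged.\<close>
      then show "d x y = e x y"
        using le[of "d x y / 2"] le[of "e x y / 2"] by (cases "d x y = 0"; cases "e x y = 0") auto
    qed
  next
    assume "d = e"
    then show "pum_dist S R D d e = 0"
      using near_imp_near_dist_le[OF d e, of 0] near_dist_nonneg[OF d e] near_refl
      by (auto simp: pum_dist_def)
  qed
next
  let ?M = "continuous_pums S R D"
  fix d e f assume d: "d \<in> ?M" and e: "e \<in> ?M" and f: "f \<in> ?M"
  have "near_dist S d f \<le> near_dist S d e + near_dist S e f + \<epsilon>" if "\<epsilon> > 0" for \<epsilon>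
  proof -
    let ?a = "near_dist S d e + \<epsilon>" and ?b = "near_dist S e f + \<epsilon>"
    have "near S ?a d e" "near S ?b e f"
      using that near_dist_less_imp_near d e f by (metis less_add_same_cancel1)+
    then have "near S (max ?a ?b) d f"
      by (meson max.cobounded1 max.cobounded2 near_mono near_trans)
    then have "near_dist S d f \<le> max ?a ?b"
      using near_imp_near_dist_le[OF d f] near_dist_nonneg[OF d e] that by auto
    also have "\<dots> \<le> near_dist S d e + near_dist S e f + \<epsilon>"
      using near_dist_nonneg[OF d e] near_dist_nonneg[OF e f] by auto
    finally show ?thesis .
  qed
  then show "pum_dist S R D d f \<le> pum_dist S R D d e + pum_dist S R D e f"
    using d e f by (auto simp: pum_dist_def intro: field_le_epsilon)
qed

text \<open>The nearness relations in a Cauchy sequence pass to its pointwise limit. Convergence is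
  therefore uniform, and boundedness and continuity survive.\<close>

lemma mcomplete_pum_dist:
  assumes R: "0 \<in> R"
  shows "Metric_space.mcomplete (continuous_pums S R D) (pum_dist S R D)"
proof -
  let ?M = "continuous_pums S R D"
  interpret Metric_space ?M "pum_dist S R D"
    by (rule Metric_space_pum_dist)
  show ?thesis
    unfolding mcomplete_def
  proof (intro allI impI)
    fix \<sigma> assume "MCauchy \<sigma>"
    then have \<sigma>: "\<And>n. \<sigma> n \<in> ?M"
      and C: "\<And>\<epsilon>. \<epsilon> > 0 \<Longrightarrow> \<exists>N. \<forall>n\<ge>N. \<forall>m\<ge>N. pum_dist S R D (\<sigma> n) (\<sigma> m) < \<epsilon>"
      unfolding MCauchy_def by (auto simp: range_subsetD)
    have near: "\<exists>N. \<forall>n\<ge>N. \<forall>m\<ge>N. near S \<epsilon> (\<sigma> n) (\<sigma> m)" if "\<epsilon> > 0" for \<epsilon>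
      using C[OF that] near_dist_less_imp_near[OF \<sigma> \<sigma>] \<sigma> by (simp add: pum_dist_def) meson
    have pum: "pseudo_ultrametric_on S (\<sigma> n)" for n
      by (rule continuous_pumsD(1)[OF \<sigma>])
    \<comment> \<open>A value that does not tend to \<open>0\<close> is eventually constant, which keeps the limit in \<open>R\<close>
      although \<open>R\<close> need not be closed.\<close>
    have "\<exists>l. (\<lambda>n. \<sigma> n x y) \<longlonglongrightarrow> l \<and> (x \<in> S \<longrightarrow> y \<in> S \<longrightarrow> l \<in> R)" for x y
    proof (cases "x \<in> S \<and> y \<in> S")
      case False
      then have "(\<lambda>n. \<sigma> n x y) = (\<lambda>n. 0)"
        using pseudo_ultrametric_onD(5)[OF pum] by (intro ext) blast
      then show ?thesis using False by auto
    next
      case True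
      show ?thesis
      proof (cases "(\<lambda>n. \<sigma> n x y) \<longlonglongrightarrow> 0")
        case True
        then show ?thesis using R by auto
      next
        case False
        then obtain \<epsilon> where \<epsilon>: "\<epsilon> > 0" "\<And>N. \<exists>n\<ge>N. \<sigma> n x y \<ge> \<epsilon>"
          using pseudo_ultrametric_onD(1)[OF pum]
          unfolding LIMSEQ_iff by (force simp: not_less)
        obtain N where N: "\<forall>n\<ge>N. \<forall>m\<ge>N. near S (\<epsilon>/2) (\<sigma> n) (\<sigma> m)"
          using near[of "\<epsilon>/2"] \<epsilon> by auto
        obtain n where n: "n \<ge> N" "\<sigma> n x y \<ge> \<epsilon>" using \<epsilon> by blast
        \<comment> \<open>At threshold \<epsilon>/2 two values can differ only if both are at most
          \<epsilon>/2, and the value at \<open>n\<close> is at least \<epsilon>.\<close>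
        have "\<sigma> m x y = \<sigma> n x y" if "m \<ge> n" for m
        proof -
          have "near S (\<epsilon>/2) (\<sigma> n) (\<sigma> m)" using N n that by auto
          then show ?thesis
            using nearD[of S "\<epsilon>/2" "\<sigma> n" "\<sigma> m" x y] \<open>x \<in> S \<and> y \<in> S\<close> n(2) \<epsilon>(1) by auto
        qed
        then have "(\<lambda>m. \<sigma> m x y) \<longlonglongrightarrow> \<sigma> n x y"
          by (intro tendsto_eventually eventually_sequentiallyI[of n])
        then show ?thesis
          using continuous_pumsD(2)[OF \<sigma>] by (intro exI[of _ "\<sigma> n x y"] conjI impI)
      qed
    qed
    then obtain l where l: "\<And>x y. (\<lambda>n. \<sigma> n x y) \<longlonglongrightarrow> l x y"
      and lR: "\<And>x y. x \<in> S \<Longrightarrow> y \<in> S \<Longrightarrow> l x y \<in> R"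
      by metis
    have lim_near: "near S \<epsilon> (\<sigma> n) l" if "\<forall>m\<ge>N. near S \<epsilon> (\<sigma> n) (\<sigma> m)" for n N \<epsilon>
      unfolding near_def
    proof (intro ballI conjI)
      fix x y assume "x \<in> S" "y \<in> S"
      then have ev: "\<forall>\<^sub>F m in sequentially. \<sigma> n x y \<le> max (\<sigma> m x y) \<epsilon>"
          "\<forall>\<^sub>F m in sequentially. \<sigma> m x y \<le> max (\<sigma> n x y) \<epsilon>"
        using that by (auto simp: near_def eventually_sequentially)
      show "\<sigma> n x y \<le> max (l x y) \<epsilon>"
        using ev(1) by (intro tendsto_lowerbound[OF tendsto_max[OF l tendsto_const]]) auto
      show "l x y \<le> max (\<sigma> n x y) \<epsilon>"
        using ev(2) by (intro tendsto_upperbound[OF l]) auto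
    qed
    have l_near: "\<exists>N. \<forall>n\<ge>N. near S \<epsilon> (\<sigma> n) l" if "\<epsilon> > 0" for \<epsilon>
      using near[OF that] lim_near by meson
    have "l \<in> ?M"
      unfolding continuous_pums_def mem_Collect_eq
    proof (intro conjI)
      show "pseudo_ultrametric_on S l"
        unfolding pseudo_ultrametric_on_def
      proof (intro conjI ballI allI impI)
        fix x y
        show "0 \<le> l x y"
          using pseudo_ultrametric_onD(1)[OF pum] by (intro LIMSEQ_le_const[OF l]) auto
        show "l x y = l y x"
          using l[of x y] l[of y x] pseudo_ultrametric_onD(2)[OF pum, of _ x y] LIMSEQ_unique by simp
        show "l x x = 0"
          using l[of x x] pseudo_ultrametric_onD(3)[OF pum] by (simp add: LIMSEQ_const_iff)
        show "l x y \<le> max (l x z) (l z y)" if "x \<in> S" "y \<in> S" "z \<in> S" for z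
          using pseudo_ultrametric_onD(4)[OF pum that]
          by (intro LIMSEQ_le[OF l tendsto_max[OF l l]]) auto
        show "l x y = 0" if "x \<notin> S \<or> y \<notin> S"
          using l[of x y] pseudo_ultrametric_onD(5)[OF pum that] by (simp add: LIMSEQ_const_iff)
      qed
      show "\<forall>x\<in>S. \<forall>y\<in>S. l x y \<in> R" using lR by blast
      obtain N where "near S 1 (\<sigma> N) l" using l_near[of 1] by auto
      moreover obtain B where "\<forall>x\<in>S. \<forall>y\<in>S. \<sigma> N x y \<le> B"
        using continuous_pumsD(3)[OF \<sigma>] by blast
      ultimately have "\<forall>x\<in>S. \<forall>y\<in>S. l x y \<le> max B 1"
        by (meson max.mono nearD(2) order.refl order.trans)
      then show "\<exists>B. \<forall>x\<in>S. \<forall>y\<in>S. l x y \<le> B" ..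
      show "finer_on S D l"
        unfolding finer_on_def
      proof (intro ballI allI impI)
        fix x and \<epsilon> :: real assume x: "x \<in> S" and \<epsilon>: "0 < \<epsilon>"
        obtain N where N: "near S (\<epsilon>/2) (\<sigma> N) l" using l_near[of "\<epsilon>/2"] \<epsilon> by auto
        obtain \<delta> where "\<delta> > 0" "\<forall>y\<in>S. D x y < \<delta> \<longrightarrow> \<sigma> N x y < \<epsilon>"
          using continuous_pumsD(4)[OF \<sigma>] x \<epsilon> unfolding finer_on_def by meson
        then show "\<exists>\<delta>>0. \<forall>y\<in>S. D x y < \<delta> \<longrightarrow> l x y < \<epsilon>"
          using near_less[OF N x, of _ \<epsilon>] \<epsilon> by (intro exI[of _ \<delta>]) auto
      qed
    qed
    moreover have "\<exists>N. \<forall>n\<ge>N. pum_dist S R D (\<sigma> n) l < \<epsilon>" if \<epsilon>: "\<epsilon> > 0" for \<epsilon>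
    proof -
      obtain N where "\<forall>n\<ge>N. near S (\<epsilon>/2) (\<sigma> n) l" using l_near[of "\<epsilon>/2"] \<epsilon> by auto
      then have "\<forall>n\<ge>N. near_dist S (\<sigma> n) l \<le> \<epsilon>/2"
        using near_imp_near_dist_le[OF \<sigma> \<open>l \<in> ?M\<close>, where \<delta> = "\<epsilon>/2"] \<epsilon> by simp
      then have "\<forall>n\<ge>N. near_dist S (\<sigma> n) l < \<epsilon>"
        using \<epsilon> by (metis field_sum_of_halves less_add_same_cancel1 half_gt_zero le_less_trans)
      then show ?thesis
        using \<sigma> \<open>l \<in> ?M\<close> by (auto simp: pum_dist_def)
    qed
    ultimately show "\<exists>l. limitin mtopology \<sigma> l sequentially"
      using \<sigma> by (intro exI[of _ l]) (auto simp: limit_metric_sequentially)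
  qed
qed

text \<open>Finitely many \<open>d\<close>-balls on which \<open>D\<close> is controlled cover
  \<open>K\<close>. A point close enough to some \<open>x\<close> in \<open>K\<close> stays in the
  ball containing \<open>x\<close>, and the ultrametric inequality for \<open>D\<close> then returns
  the same \<epsilon>, without halving.\<close>

lemma compactin_uniform_finer:
  assumes D: "pseudo_ultrametric_on S D" and d: "ultrametric_on S d" and fin: "finer_on S d D"
    and K: "compactin (Metric_space.mtopology S d) K" and "0 < \<epsilon>"
  shows "\<exists>\<delta>>0. \<forall>x\<in>K. \<forall>y\<in>S. d x y < \<delta> \<longrightarrow> D x y < \<epsilon>"
proof -
  interpret Metric_space S d
    using d by (rule ultrametric_on_Metric_space)
  have pd: "pseudo_ultrametric_on S d" using d by (simp add: ultrametric_on_def)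
  obtain \<delta> where \<delta>: "\<And>x. x \<in> S \<Longrightarrow> 0 < \<delta> x"
    "\<And>x y. x \<in> S \<Longrightarrow> y \<in> S \<Longrightarrow> d x y < \<delta> x \<Longrightarrow> D x y < \<epsilon>"
    using bchoice[of S "\<lambda>x \<delta>. 0 < \<delta> \<and> (\<forall>y\<in>S. d x y < \<delta> \<longrightarrow> D x y < \<epsilon>)"] fin \<open>0 < \<epsilon>\<close>
    unfolding finer_on_def by blast
  have KS: "K \<subseteq> S" using K by (auto simp: compactin_def)
  have "\<exists>\<F>. finite \<F> \<and> \<F> \<subseteq> (\<lambda>x. mball x (\<delta> x)) ` K \<and> K \<subseteq> \<Union>\<F>"
    using K KS \<delta>(1) by (intro compactinD) auto
  then obtain \<F> where \<F>: "finite \<F>" "\<F> \<subseteq> (\<lambda>x. mball x (\<delta> x)) ` K" "K \<subseteq> \<Union>\<F>"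
    by blast
  obtain F where F: "F \<subseteq> K" "finite F" "\<F> = (\<lambda>x. mball x (\<delta> x)) ` F"
    using finite_subset_image[OF \<F>(1,2)] by blast
  \<comment> \<open>The extra 1 keeps the minimum meaningful when \<open>F\<close> is empty.\<close>
  define m where "m = Min (insert 1 (\<delta> ` F))"
  have m: "0 < m" "\<And>x. x \<in> F \<Longrightarrow> m \<le> \<delta> x"
    using F KS \<delta>(1) by (auto simp: m_def)
  have "D x y < \<epsilon>" if xy: "x \<in> K" "y \<in> S" "d x y < m" for x y
  proof -
    obtain z where z: "z \<in> F" "d z x < \<delta> z" using F \<F>(3) xy(1) by auto
    have S: "x \<in> S" "y \<in> S" "z \<in> S" using z F KS that by auto
    have "d z y < \<delta> z"
      using pseudo_ultrametric_on_less[OF pd S(3,2,1), of "\<delta> z"] z m(2)[OF z(1)] xy by linarith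
    then have "D z y < \<epsilon>" "D z x < \<epsilon>" using \<delta>(2) S z by auto
    then show ?thesis
      using pseudo_ultrametric_on_less[OF D S] pseudo_ultrametric_onD(2)[OF D, of x z] by simp
  qed
  then show ?thesis using m by blast
qed

lemma sigma_compact_imp_completely_metrizable:
  assumes R: "characteristic_range_set R" and X: "ultrametrizable_space X"
    and sc: "sigma_compact_space X"
  shows "completely_metrizable_space (UMet_bd_topology X R)"
proof -
  define S where "S = topspace X"
  obtain D where D: "ultrametric_on S D" and DX: "Metric_space.mtopology S D = X"
    using X unfolding ultrametrizable_space_def S_def by blast
  have pD: "pseudo_ultrametric_on S D" using D by (simp add: ultrametric_on_def)
  obtain \<K> where \<K>: "countable \<K>" "\<And>K. K \<in> \<K> \<Longrightarrow> compactin X K" "\<Union>\<K> = S"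
    using sc unfolding sigma_compact_space_def S_def[symmetric] by auto
  let ?M = "continuous_pums S R D"
  interpret Metric_space ?M "pum_dist S R D"
    by (rule Metric_space_pum_dist)
  define G where "G K \<epsilon> = {d\<in>?M. \<exists>\<delta>>0. \<forall>x\<in>K. \<forall>y\<in>S. d x y < \<delta> \<longrightarrow> D x y < \<epsilon>}" for K and \<epsilon> :: real
  \<comment> \<open>Including \<open>?M\<close> keeps the intersection inside the complete space,
    even if \<open>\<K>\<close> is empty.\<close>
  define \<G> where "\<G> = insert ?M ((\<lambda>(K, n). G K (1 / Suc n)) ` (\<K> \<times> UNIV))"
  have G_open: "openin mtopology (G K \<epsilon>)" if "K \<subseteq> S" for K \<epsilon>
    unfolding openin_mtopology
  proof (intro conjI allI impI)
    show "G K \<epsilon> \<subseteq> ?M" by (auto simp: G_def)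
    fix d assume "d \<in> G K \<epsilon>"
    then obtain \<delta> where d: "d \<in> ?M" and \<delta>: "\<delta> > 0" "\<And>x y. x \<in> K \<Longrightarrow> y \<in> S \<Longrightarrow> d x y < \<delta> \<Longrightarrow> D x y < \<epsilon>"
      by (auto simp: G_def)
    \<comment> \<open>The same \<delta> works for \<open>e\<close>, since nearness at a threshold
      below \<delta> preserves which pairs have distance less than \<delta>.\<close>
    have "e \<in> G K \<epsilon>" if "e \<in> mball d \<delta>" for e
    proof -
      have e: "e \<in> ?M" "near_dist S e d < \<delta>"
        using that near_dist_commute[of S e d] by (auto simp: mball_def pum_dist_def)
      then obtain \<gamma> where \<gamma>: "\<gamma> < \<delta>" "near S \<gamma> e d"
        using near_dist_less_iff[OF e(1) d] by blast
      have "D x y < \<epsilon>" if "x \<in> K" "y \<in> S" "e x y < \<delta>" for x y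
        using near_less[OF \<gamma>(2) _ that(2,3) \<gamma>(1)] \<delta>(2) that \<open>K \<subseteq> S\<close> by blast
      then show ?thesis using e \<delta>(1) by (auto simp: G_def)
    qed
    then show "\<exists>r>0. mball d r \<subseteq> G K \<epsilon>" using \<delta> by blast
  qed
  have KS: "K \<subseteq> S" if "K \<in> \<K>" for K using that \<K> by auto
  \<comment> \<open>Compactness gives the uniform \<delta> on each \<open>K\<close>. Conversely,
    every point lies in some \<open>K\<close>, and the uniform \<delta> there is a pointwise
    one.\<close>
  have U: "UMet_bd X R = \<Inter>\<G>"
  proof (intro equalityI subsetI)
    fix d assume "d \<in> UMet_bd X R"
    then have dX: "Metric_space.mtopology S d = X" "ultrametric_on S d" "finer_on S d D" and dM: "d \<in> ?M"
      using mem_UMet_bd_iff[of X D d R] D DX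
      by (auto simp: UMet_bd_def S_def continuous_pums_def ultrametric_on_def)
    have "d \<in> G K (1 / Suc n)" if "K \<in> \<K>" for K n
      using compactin_uniform_finer[OF pD dX(2,3), of K "1 / Suc n"] \<K>(2)[OF that] dM
      by (auto simp: G_def dX(1))
    then show "d \<in> \<Inter>\<G>" using dM by (auto simp: \<G>_def)
  next
    fix d assume d: "d \<in> \<Inter>\<G>"
    then have dM: "d \<in> ?M" by (auto simp: \<G>_def)
    have pd: "pseudo_ultrametric_on S d" using continuous_pumsD(1)[OF dM] .
    have fin: "finer_on S d D"
      unfolding finer_on_def
    proof (intro ballI allI impI)
      fix x and \<epsilon> :: real assume "x \<in> S" "0 < \<epsilon>"
      then obtain K n where "x \<in> K" "K \<in> \<K>" "1 / Suc n < \<epsilon>"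
        using \<K>(3) nat_approx_posE by (metis UnionE)
      moreover have "d \<in> G K (1 / Suc n)" using d \<open>K \<in> \<K>\<close> by (auto simp: \<G>_def)
      ultimately show "\<exists>\<delta>>0. \<forall>y\<in>S. d x y < \<delta> \<longrightarrow> D x y < \<epsilon>"
        by (fastforce simp: G_def)
    qed
    \<comment> \<open>Separation is inherited from \<open>D\<close>: points at
      \<open>d\<close>-distance 0 have \<open>D\<close>-distance below every \<epsilon>.\<close>
    have "x = y" if "x \<in> S" "y \<in> S" "d x y = 0" for x y
    proof -
      have "D x y < \<epsilon>" if "0 < \<epsilon>" for \<epsilon>
        using fin \<open>0 < \<epsilon>\<close> \<open>x \<in> S\<close> \<open>y \<in> S\<close> \<open>d x y = 0\<close> unfolding finer_on_def by metis
      then have "D x y = 0"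
        using pseudo_ultrametric_onD(1)[OF pD, of x y] by (metis less_irrefl order_le_less)
      then show ?thesis using D that by (auto simp: ultrametric_on_def)
    qed
    then have "ultrametric_on S d" using pd by (auto simp: ultrametric_on_def)
    then show "d \<in> UMet_bd X R"
      using mem_UMet_bd_iff[of X D d R] D DX fin dM by (auto simp: S_def continuous_pums_def)
  qed
  have UM: "UMet_bd X R \<subseteq> ?M" unfolding U \<G>_def by auto
  have "gdelta_in mtopology (UMet_bd X R)"
    unfolding U
  proof (rule gdelta_in_Inter)
    show "countable \<G>" using \<K> by (auto simp: \<G>_def)
    show "\<G> \<noteq> {}" by (auto simp: \<G>_def)
    show "gdelta_in mtopology A" if "A \<in> \<G>" for A
      using that G_open KS open_imp_gdelta_in[of mtopology] openin_topspace[of mtopology]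
      by (auto simp: \<G>_def)
  qed
  then have "completely_metrizable_space (subtopology mtopology (UMet_bd X R))"
    using mcomplete_pum_dist[OF characteristic_range_setD(2)[OF R]] Metric_space_axioms
    by (intro completely_metrizable_space_gdelta_in) (unfold completely_metrizable_space_def, blast)
  moreover have "subtopology mtopology (UMet_bd X R) = UMet_bd_topology X R"
    unfolding topology_eq
  proof (intro allI)
    fix W
    interpret Submetric ?M "pum_dist S R D" "UMet_bd X R"
      by unfold_locales (rule UM)
    have ball: "e \<in> sub.mball d r \<longleftrightarrow> e \<in> UMet_bd X R \<and> (\<exists>\<delta>\<ge>0. \<delta> < r \<and> near S \<delta> d e)"
      if "d \<in> UMet_bd X R" for d e r
      using that subsetD[OF UM, of d] subsetD[OF UM, of e] near_dist_less_iff[of d S R D e r]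
      by (auto simp: sub.mball_def pum_dist_def)
    \<comment> \<open>Real radii and thresholds from \<open>R\<close> are interchangeable because
      \<open>R\<close> has positive elements below every positive real.\<close>
    have "(\<exists>r>0. sub.mball d r \<subseteq> W) \<longleftrightarrow> (\<exists>\<delta>\<in>R - {0}. \<forall>e\<in>UMet_bd X R. near S \<delta> d e \<longrightarrow> e \<in> W)"
      if "d \<in> UMet_bd X R" for d
    proof
      assume "\<exists>r>0. sub.mball d r \<subseteq> W"
      then obtain r where "r > 0" "sub.mball d r \<subseteq> W" by blast
      moreover obtain \<delta> where "\<delta> \<in> R - {0}" "0 < \<delta>" "\<delta> < r"
        using characteristic_range_setD(3)[OF R \<open>r > 0\<close>] by blast
      ultimately show "\<exists>\<delta>\<in>R - {0}. \<forall>e\<in>UMet_bd X R. near S \<delta> d e \<longrightarrow> e \<in> W"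
        using ball[OF that, of _ r] by (intro bexI[of _ \<delta>]) (blast intro: less_imp_le)+
    next
      assume "\<exists>\<delta>\<in>R - {0}. \<forall>e\<in>UMet_bd X R. near S \<delta> d e \<longrightarrow> e \<in> W"
      then obtain \<delta> where \<delta>: "\<delta> \<in> R - {0}" "\<forall>e\<in>UMet_bd X R. near S \<delta> d e \<longrightarrow> e \<in> W" by blast
      then have "0 < \<delta>" using characteristic_range_setD(1)[OF R] by force
      moreover have "sub.mball d \<delta> \<subseteq> W"
        using ball[OF that] \<delta>(2) near_mono by (meson less_imp_le subsetI)
      ultimately show "\<exists>r>0. sub.mball d r \<subseteq> W" by blast
    qed
    then have "openin sub.mtopology W \<longleftrightarrow> openin (UMet_bd_topology X R) W"
      unfolding openin_UMet_bd_topology[OF R] sub.openin_mtopology S_def[symmetric] by blast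
    then show "openin (subtopology mtopology (UMet_bd X R)) W \<longleftrightarrow> openin (UMet_bd_topology X R) W"
      by (simp only: mtopology_submetric)
  qed
  ultimately show ?thesis by simp
qed

section \<open>The covering game\<close>

text \<open>A strategy of TWO is a transition \<open>step\<close> on positions together with an
  answer \<open>bound\<close> read off the new position. In each position countably many moves of
  ONE suffice to make the set of points covered by all the answers small. If ONE plays only such
  moves, countably many positions are reachable, and a point outside all their small sets would let
  ONE escape TWO's bound in every round.\<close>

lemma covering_game_winning_imp_small:
  fixes s\<^sub>0 :: 's and \<F> :: "('a \<Rightarrow> nat) set"
  assumes win: "\<And>st f x. st 0 = s\<^sub>0 \<Longrightarrow> (\<And>n. st (Suc n) = step (st n) (f n)) \<Longrightarrow> (\<And>n. f n \<in> \<F>) \<Longrightarrow>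
      x \<in> S \<Longrightarrow> \<exists>n. f n x < bound (st (Suc n))"
    and cover: "\<And>k. \<exists>C\<subseteq>\<F>. countable C \<and> {x \<in> S. \<forall>f\<in>C. f x < k f} \<in> \<I>"
    and Un: "\<And>\<A>. countable \<A> \<Longrightarrow> \<A> \<subseteq> \<I> \<Longrightarrow> \<Union>\<A> \<in> \<I>"
  shows "\<exists>A\<in>\<I>. S \<subseteq> A"
proof -
  have "\<exists>C. \<forall>s. C s \<subseteq> \<F> \<and> countable (C s) \<and> {x \<in> S. \<forall>f\<in>C s. f x < bound (step s f)} \<in> \<I>"
    by (rule choice, rule allI, rule cover)
  then obtain C where
    "\<forall>s. C s \<subseteq> \<F> \<and> countable (C s) \<and> {x \<in> S. \<forall>f\<in>C s. f x < bound (step s f)} \<in> \<I>" ..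
  then have C: "\<And>s. C s \<subseteq> \<F>" "\<And>s. countable (C s)"
    "\<And>s. {x \<in> S. \<forall>f\<in>C s. f x < bound (step s f)} \<in> \<I>"
    by simp_all
  define T where "T s = {x \<in> S. \<forall>f\<in>C s. f x < bound (step s f)}" for s
  define L where "L = rec_nat {s\<^sub>0} (\<lambda>_ L. \<Union>s\<in>L. step s ` C s)"
  have L: "L 0 = {s\<^sub>0}" "\<And>n. L (Suc n) = (\<Union>s\<in>L n. step s ` C s)"
    by (simp_all add: L_def)
  have "countable (L n)" for n
    by (induction n) (auto simp: L C)
  then have "countable (T ` (\<Union>n. L n))"
    by blast
  then have "\<Union>(T ` (\<Union>n. L n)) \<in> \<I>"
    using C(3) by (intro Un) (auto simp: T_def)
  moreover have "S \<subseteq> \<Union>(T ` (\<Union>n. L n))"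
  proof
    fix x assume x: "x \<in> S"
    show "x \<in> \<Union>(T ` (\<Union>n. L n))"
    proof (rule ccontr)
      assume "x \<notin> \<Union>(T ` (\<Union>n. L n))"
      then have "\<forall>s. \<exists>f. s \<in> (\<Union>n. L n) \<longrightarrow> f \<in> C s \<and> bound (step s f) \<le> f x"
        using x by (auto simp: T_def not_less)
      then obtain F where F: "\<And>s. s \<in> (\<Union>n. L n) \<Longrightarrow> F s \<in> C s \<and> bound (step s (F s)) \<le> F s x"
        by metis
      define st where "st = rec_nat s\<^sub>0 (\<lambda>_ s. step s (F s))"
      have st: "st 0 = s\<^sub>0" "\<And>n. st (Suc n) = step (st n) (F (st n))"
        by (simp_all add: st_def)
      have "st n \<in> L n" for n
        by (induction n) (use F in \<open>auto simp: L st\<close>)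
      then have stL: "st n \<in> (\<Union>n. L n)" for n by blast
      then have "\<exists>n. F (st n) x < bound (st (Suc n))"
        using F C(1) x by (intro win[of st]) (auto simp: st)
      then show False
        using F[OF stL] by (auto simp: st not_le[symmetric])
    qed
  qed
  ultimately show ?thesis by blast
qed

text \<open>In a well-order of \<open>Q\<close>, either all initial segments are countable, or the
  least point with an uncountable segment cuts off a suitable subset. That point itself is removed,
  as the segments include their endpoint.\<close>

lemma uncountable_imp_omega1_like:
  assumes "uncountable Q"
  obtains r Q' where "Q' \<subseteq> Q" "uncountable Q'" "\<And>q. q \<in> Q' \<Longrightarrow> countable {p \<in> Q'. (p, q) \<in> r}"
    "\<And>p q. p \<in> Q' \<Longrightarrow> q \<in> Q' \<Longrightarrow> (p, q) \<in> r \<or> (q, p) \<in> r"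
proof -
  obtain r where r: "well_order_on Q r" using well_order_on by blast
  then have total: "total_on Q r" and refl: "refl_on Q r" and wf: "wf (r - Id)"
    by (auto simp: well_order_on_def linear_order_on_def partial_order_on_def preorder_on_def)
  have tot: "(p, q) \<in> r \<or> (q, p) \<in> r" if "p \<in> Q" "q \<in> Q" for p q
    using total refl that unfolding total_on_def refl_on_def by (cases "p = q") auto
  define seg where "seg q = {p \<in> Q. (p, q) \<in> r}" for q
  show thesis
  proof (cases "\<exists>q\<in>Q. uncountable (seg q)")
    case False
    show thesis
      by (rule that[of Q r]) (use assms False tot in \<open>auto simp: seg_def\<close>)
  next
    case True
    then obtain q where q: "q \<in> {q \<in> Q. uncountable (seg q)}" by blast
    then have "\<exists>q\<^sub>0\<in>{q \<in> Q. uncountable (seg q)}. \<forall>p. (p, q\<^sub>0) \<in> r - Id \<longrightarrow> p \<notin> {q \<in> Q. uncountable (seg q)}"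
      using wf[unfolded wf_eq_minimal, rule_format, of q "{q \<in> Q. uncountable (seg q)}"] by blast
    then obtain q\<^sub>0 where q\<^sub>0: "q\<^sub>0 \<in> Q" "uncountable (seg q\<^sub>0)"
      and min: "\<And>p. (p, q\<^sub>0) \<in> r - Id \<Longrightarrow> p \<in> Q \<Longrightarrow> countable (seg p)"
      by auto
    show thesis
    proof (rule that[of "seg q\<^sub>0 - {q\<^sub>0}" r])
      show "uncountable (seg q\<^sub>0 - {q\<^sub>0})"
        using q\<^sub>0 by (simp add: uncountable_minus_countable)
      fix q assume "q \<in> seg q\<^sub>0 - {q\<^sub>0}"
      then have "countable (seg q)" using min by (auto simp: seg_def)
      then show "countable {p \<in> seg q\<^sub>0 - {q\<^sub>0}. (p, q) \<in> r}"
        by (rule countable_subset[rotated]) (auto simp: seg_def)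
    qed (use tot in \<open>auto simp: seg_def\<close>)
  qed
qed

text \<open>The functions \<open>\<phi>\<close> below form the transpose of an Ulam matrix: if \<open>e q\<close> injects the initial segment
  of \<open>q\<close> into \<open>\<nat>\<close>, then \<open>\<phi> a q = e q a\<close>. Infinitely many \<open>\<phi> a\<close> share one bound \<open>m\<close>, and a point \<open>q\<close>
  above all these \<open>a\<close> cannot satisfy \<open>e q a < m\<close> for each of them.\<close>

lemma uncountable_imp_unbounded_functions:
  fixes Q :: "'q set"
  assumes "uncountable Q"
  obtains Q' where "Q' \<subseteq> Q" "uncountable Q'"
    "\<And>k :: ('q \<Rightarrow> nat) \<Rightarrow> nat. \<exists>C. countable C \<and> countable {q \<in> Q'. \<forall>\<phi>\<in>C. \<phi> q < k \<phi>}"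
proof -
  obtain r Q' where Q': "Q' \<subseteq> Q" "uncountable Q'"
    and seg: "\<And>q. q \<in> Q' \<Longrightarrow> countable {p \<in> Q'. (p, q) \<in> r}"
    and tot: "\<And>p q. p \<in> Q' \<Longrightarrow> q \<in> Q' \<Longrightarrow> (p, q) \<in> r \<or> (q, p) \<in> r"
    by (rule uncountable_imp_omega1_like[OF assms]) (rule that)
  define \<phi> where "\<phi> a q = to_nat_on {p \<in> Q'. (p, q) \<in> r} a" for a q
  have "\<exists>C. countable C \<and> countable {q \<in> Q'. \<forall>\<phi>\<in>C. \<phi> q < k \<phi>}" for k :: "('q \<Rightarrow> nat) \<Rightarrow> nat"
  proof -
    have "\<exists>m. infinite {a \<in> Q'. k (\<phi> a) = m}"
    proof (rule ccontr)
      assume "\<not> ?thesis"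
      then have "countable (\<Union>m. {a \<in> Q'. k (\<phi> a) = m})"
        by (intro countable_UN) (auto intro: countable_finite)
      moreover have "(\<Union>m. {a \<in> Q'. k (\<phi> a) = m}) = Q'" by auto
      ultimately show False using Q' by simp
    qed
    then obtain m where "infinite {a \<in> Q'. k (\<phi> a) = m}" by blast
    then obtain E where E: "E \<subseteq> {a \<in> Q'. k (\<phi> a) = m}" "countable E" "infinite E"
      using infinite_countable_subset' by blast
    have "{q \<in> Q'. \<forall>f\<in>\<phi> ` E. f q < k f} \<subseteq> (\<Union>a\<in>E. {p \<in> Q'. (p, a) \<in> r})"
    proof (clarify, rule ccontr)
      fix q assume q: "q \<in> Q'" "\<forall>f\<in>\<phi> ` E. f q < k f" "q \<notin> (\<Union>a\<in>E. {p \<in> Q'. (p, a) \<in> r})"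
      have sub: "E \<subseteq> {p \<in> Q'. (p, q) \<in> r}"
        using q E tot by blast
      then have "inj_on (to_nat_on {p \<in> Q'. (p, q) \<in> r}) E"
        using seg[OF q(1)] inj_on_to_nat_on inj_on_subset by blast
      moreover have "to_nat_on {p \<in> Q'. (p, q) \<in> r} ` E \<subseteq> {..<m}"
        using q(2) E(1) by (auto simp: \<phi>_def)
      ultimately show False
        using E(3) inj_on_finite by blast
    qed
    moreover have "countable (\<Union>a\<in>E. {p \<in> Q'. (p, a) \<in> r})"
      using E seg by (intro countable_UN) auto
    ultimately have "countable {q \<in> Q'. \<forall>f\<in>\<phi> ` E. f q < k f}"
      by (rule countable_subset)
    then show ?thesis using E by (intro exI[of _ "\<phi> ` E"]) auto
  qed
  then show thesis by (rule that[OF Q'])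
qed

section \<open>Locally constant functions and compactness\<close>

definition locally_constant_on :: "'a set \<Rightarrow> ('a \<Rightarrow> 'a \<Rightarrow> real) \<Rightarrow> ('a \<Rightarrow> nat) \<Rightarrow> bool" where
  "locally_constant_on S D f \<longleftrightarrow> (\<forall>x\<in>S. \<exists>\<delta>>0. \<forall>y\<in>S. D x y < \<delta> \<longrightarrow> f y = f x)"

lemma locally_constant_onE:
  assumes "locally_constant_on S D f" "x \<in> S"
  obtains \<delta> where "\<delta> > 0" "\<And>y. y \<in> S \<Longrightarrow> D x y < \<delta> \<Longrightarrow> f y = f x"
  using assms unfolding locally_constant_on_def by blast

lemma locally_constant_on_max:
  assumes "locally_constant_on S D f" "locally_constant_on S D g"
  shows "locally_constant_on S D (\<lambda>x. max (f x) (g x))"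
  unfolding locally_constant_on_def
proof
  fix x assume x: "x \<in> S"
  obtain \<delta> where \<delta>: "\<delta> > 0" "\<And>y. y \<in> S \<Longrightarrow> D x y < \<delta> \<Longrightarrow> f y = f x"
    using locally_constant_onE[OF assms(1) x] by blast
  obtain \<delta>' where \<delta>': "\<delta>' > 0" "\<And>y. y \<in> S \<Longrightarrow> D x y < \<delta>' \<Longrightarrow> g y = g x"
    using locally_constant_onE[OF assms(2) x] by blast
  show "\<exists>\<delta>>0. \<forall>y\<in>S. D x y < \<delta> \<longrightarrow> max (f y) (g y) = max (f x) (g x)"
    by (rule exI[of _ "min \<delta> \<delta>'"]) (use \<delta> \<delta>' in auto)
qed

lemma openin_locally_constant_on:
  assumes "Metric_space S D" "locally_constant_on S D f"
  shows "openin (Metric_space.mtopology S D) {x \<in> S. P (f x)}"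
proof -
  interpret Metric_space S D by fact
  show ?thesis
    unfolding openin_mtopology
  proof (intro conjI allI impI)
    fix x assume x: "x \<in> {x \<in> S. P (f x)}"
    then obtain \<delta> where \<delta>: "\<delta> > 0" "\<And>y. y \<in> S \<Longrightarrow> D x y < \<delta> \<Longrightarrow> f y = f x"
      using locally_constant_onE[OF assms(2)] by blast
    have "f y = f x" if "y \<in> mball x \<delta>" for y
      using that by (intro \<delta>(2)) auto
    then have "mball x \<delta> \<subseteq> {x \<in> S. P (f x)}"
      using x by auto
    then show "\<exists>r>0. mball x r \<subseteq> {x \<in> S. P (f x)}"
      using \<delta>(1) by blast
  qed auto
qed

lemma ultrametric_ball_eq:
  assumes D: "pseudo_ultrametric_on S D" and S: "x \<in> S" "y \<in> S" and "D x y < c"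
  shows "{z \<in> S. D x z < c} = {z \<in> S. D y z < c}"
  using pseudo_ultrametric_on_less[OF D] pseudo_ultrametric_onD(2)[OF D] assms by (metis (no_types, lifting))

text \<open>Otherwise some sequence \<sigma> in \<open>C\<close> has no subsequence converging in
  \<open>C\<close>, hence none converging in \<open>S\<close> since \<open>C\<close> is closed. Each
  \<open>y\<close> then has a ball of radius \<open>1 / Suc j\<close> containing \<sigma>
  \<open>n\<close> for finitely many \<open>n\<close> only. Taking the least such \<open>j\<close>,
  let \<open>f y\<close> be the largest of these \<open>n\<close>. Then \<open>f\<close> is locally
  constant, but its value at \<sigma> \<open>n\<close> is at least \<open>n\<close>.\<close>

lemma compactin_if_locally_constant_bounded:
  assumes D: "ultrametric_on S D" and C: "closedin (Metric_space.mtopology S D) C"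
    and bdd: "\<And>f. locally_constant_on S D f \<Longrightarrow> \<exists>b. \<forall>x\<in>C. f x \<le> b"
  shows "compactin (Metric_space.mtopology S D) C"
proof (rule ccontr)
  interpret Metric_space S D
    using D by (rule ultrametric_on_Metric_space)
  have pD: "pseudo_ultrametric_on S D" using D by (simp add: ultrametric_on_def)
  have CS: "C \<subseteq> S" using C closedin_subset by fastforce
  assume "\<not> compactin mtopology C"
  then obtain \<sigma> :: "nat \<Rightarrow> 'a" where \<sigma>: "range \<sigma> \<subseteq> C"
    and nolim: "\<And>l r. l \<in> C \<Longrightarrow> strict_mono r \<Longrightarrow> \<not> limitin mtopology (\<sigma> \<circ> r) l sequentially"
    using CS unfolding compactin_sequentially by blast
  have \<sigma>S: "\<sigma> n \<in> S" for n using \<sigma> CS by blast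
  define A where "A y j = {n. D y (\<sigma> n) < 1 / Suc j}" for y j
  have fin: "\<exists>j. finite (A y j)" if y: "y \<in> S" for y
  proof (rule ccontr)
    assume "\<not> ?thesis"
    then have inf: "\<exists>n>m. n \<in> A y j" for m j
      using infinite_nat_iff_unbounded by blast
    have "\<exists>r. \<forall>j. r j \<in> A y j \<and> r j < r (Suc j)"
      using inf by (intro dependent_nat_choice) blast+
    then obtain r where r: "\<And>j. r j \<in> A y j" "\<And>j. r j < r (Suc j)" by blast
    have "limitin mtopology (\<sigma> \<circ> r) y sequentially"
      unfolding limit_metric_sequentially
    proof (intro conjI allI impI)
      fix \<epsilon> :: real assume "0 < \<epsilon>"
      then obtain N where N: "1 / Suc N < \<epsilon>" using nat_approx_posE by blast
      have "D ((\<sigma> \<circ> r) n) y < \<epsilon>" if "N \<le> n" for n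
      proof -
        have "D y (\<sigma> (r n)) < 1 / Suc n" using r(1)[of n] by (simp add: A_def)
        also have "\<dots> \<le> 1 / Suc N" using that by (simp add: frac_le)
        finally show ?thesis using N by (simp add: commute)
      qed
      then show "\<exists>N. \<forall>n\<ge>N. (\<sigma> \<circ> r) n \<in> S \<and> D ((\<sigma> \<circ> r) n) y < \<epsilon>"
        using \<sigma>S by auto
    qed (fact y)
    moreover from this have "y \<in> C"
      using \<sigma> by (intro limitin_closedin[OF _ C]) (auto simp: range_subsetD)
    moreover have "strict_mono r" using r(2) by (simp add: strict_mono_Suc_iff)
    ultimately show False using nolim by blast
  qed
  define k where "k y = (LEAST j. finite (A y j))" for y
  define f where "f y = Max (insert 0 (A y (k y)))" for y
  have k: "finite (A y (k y))" if "y \<in> S" for y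
    unfolding k_def using fin[OF that] by (rule LeastI_ex)
  have "f z = f y" if S: "y \<in> S" "z \<in> S" and yz: "D y z < 1 / Suc (k y)" for y z
  proof -
    have eq: "A z j = A y j" if "j \<le> k y" for j
    proof -
      have "1 / Suc (k y) \<le> 1 / Suc j" using that by (simp add: frac_le)
      then have "{u \<in> S. D y u < 1 / Suc j} = {u \<in> S. D z u < 1 / Suc j}"
        using yz by (intro ultrametric_ball_eq[OF pD S]) linarith
      then show ?thesis using \<sigma>S by (auto simp: A_def)
    qed
    \<comment> \<open>All balls of radius at least \<open>1 / Suc (k y)\<close> about
      \<open>y\<close> and \<open>z\<close> coincide, so the search for the least index meets the
      same sets up to \<open>k y\<close>.\<close>
    have "k z = k y"
      unfolding k_def[of z]
    proof (rule Least_equality)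
      show "finite (A z (k y))" using k[OF S(1)] eq by simp
      show "k y \<le> j" if "finite (A z j)" for j
        using that eq[of j] Least_le[of "\<lambda>j. finite (A y j)" j] unfolding k_def
        by (cases "j \<le> k y") (auto simp: k_def)
    qed
    then show ?thesis by (simp add: f_def eq)
  qed
  then have "locally_constant_on S D f"
    unfolding locally_constant_on_def by (metis of_nat_0_less_iff zero_less_Suc zero_less_divide_1_iff)
  then obtain b where b: "\<And>x. x \<in> C \<Longrightarrow> f x \<le> b" using bdd by blast
  have "Suc b \<in> A (\<sigma> (Suc b)) (k (\<sigma> (Suc b)))"
    using pseudo_ultrametric_onD(3)[OF pD] by (simp add: A_def)
  then have "Suc b \<le> f (\<sigma> (Suc b))"
    using k[OF \<sigma>S] by (simp add: f_def)
  then show False using b[of "\<sigma> (Suc b)"] \<sigma> by auto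
qed

lemma characteristic_range_set_seq:
  assumes R: "characteristic_range_set R"
  obtains r :: "nat \<Rightarrow> real" where "\<And>n. r n \<in> R" "\<And>n. 0 < r n" "\<And>m n. m \<le> n \<Longrightarrow> r n \<le> r m"
    "\<And>\<epsilon>. 0 < \<epsilon> \<Longrightarrow> \<exists>n. r n < \<epsilon>"
proof -
  have "\<exists>r. \<forall>n. (r n \<in> R \<and> 0 < r n \<and> r n < 1 / Suc n) \<and> r (Suc n) < r n"
  proof (rule dependent_nat_choice)
    show "\<exists>x. x \<in> R \<and> 0 < x \<and> x < 1 / Suc 0"
      using characteristic_range_setD(3)[OF R, of "1 / Suc 0"] by auto
    fix x :: real and n assume "x \<in> R \<and> 0 < x \<and> x < 1 / Suc n"
    then show "\<exists>y. (y \<in> R \<and> 0 < y \<and> y < 1 / Suc (Suc n)) \<and> y < x"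
      using characteristic_range_setD(3)[OF R, of "min x (1 / Suc (Suc n))"] by auto
  qed
  then obtain r where r: "\<And>n. r n \<in> R" "\<And>n. 0 < r n" "\<And>n. r n < 1 / Suc n" "\<And>n. r (Suc n) < r n"
    by auto
  have "r n \<le> r m" if "m \<le> n" for m n
    using lift_Suc_antimono_le[of r m n] r(4) that by (simp add: less_imp_le)
  moreover have "\<exists>n. r n < \<epsilon>" if "0 < \<epsilon>" for \<epsilon>
    using that r(3) by (meson less_trans nat_approx_posE)
  ultimately show thesis by (rule that[OF r(1,2)])
qed

section \<open>Perturbing ultrametrics\<close>

lemma UMet_bdD:
  assumes "d \<in> UMet_bd X R"
  shows "ultrametric_on (topspace X) d" "pseudo_ultrametric_on (topspace X) d"
    "x \<in> topspace X \<Longrightarrow> y \<in> topspace X \<Longrightarrow> d x y \<in> R"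
    "\<exists>B. \<forall>x\<in>topspace X. \<forall>y\<in>topspace X. d x y \<le> B"
    "Metric_space.mtopology (topspace X) d = X"
  using assms by (auto simp: UMet_bd_def ultrametric_on_def)

lemma UMet_bd_finer:
  assumes "d \<in> UMet_bd X R" "e \<in> UMet_bd X R"
  shows "finer_on (topspace X) d e"
  using mem_UMet_bd_iff[OF UMet_bdD(1,5)[OF assms(2)], of d R] assms(1) by blast

lemma UMet_bdI:
  assumes "ultrametric_on (topspace X) D" "Metric_space.mtopology (topspace X) D = X"
    and "pseudo_ultrametric_on (topspace X) d"
    and "\<forall>x\<in>topspace X. \<forall>y\<in>topspace X. d x y = 0 \<longrightarrow> x = y"
    and "\<forall>x\<in>topspace X. \<forall>y\<in>topspace X. d x y \<in> R"
    and "\<exists>B. \<forall>x\<in>topspace X. \<forall>y\<in>topspace X. d x y \<le> B"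
    and "finer_on (topspace X) D d" "finer_on (topspace X) d D"
  shows "d \<in> UMet_bd X R"
  unfolding mem_UMet_bd_iff[OF assms(1,2)] ultrametric_on_def
  by (intro conjI assms)

lemma finer_onE:
  assumes "finer_on S d e" "x \<in> S" "0 < \<epsilon>"
  obtains \<delta> where "0 < \<delta>" "\<forall>y\<in>S. d x y < \<delta> \<longrightarrow> e x y < \<epsilon>"
  using assms unfolding finer_on_def by blast

text \<open>Composing a generating ultrametric with a nondecreasing map \<psi> on the nonnegative
  reals that takes values in \<open>R\<close>, vanishes only at 0, is bounded by \<open>r 0\<close>
  and is continuous at 0 keeps the topology.\<close>

lemma UMet_bd_nonempty:
  assumes R: "characteristic_range_set R" and X: "ultrametrizable_space X"
  shows "UMet_bd X R \<noteq> {}"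
proof -
  define S where "S = topspace X"
  obtain D where D: "ultrametric_on S D" and DX: "Metric_space.mtopology S D = X"
    using X unfolding ultrametrizable_space_def S_def by blast
  have pD: "pseudo_ultrametric_on S D" using D by (simp add: ultrametric_on_def)
  obtain r :: "nat \<Rightarrow> real" where rR: "\<And>n. r n \<in> R" and rpos: "\<And>n. 0 < r n"
    and rmono: "\<And>m n. m \<le> n \<Longrightarrow> r n \<le> r m" and rlim: "\<And>\<epsilon>. 0 < \<epsilon> \<Longrightarrow> \<exists>n. r n < \<epsilon>"
    by (rule characteristic_range_set_seq[OF R]) (rule that)
  define \<psi> where "\<psi> t = (if t = 0 then 0 else r (nat \<lfloor>1 / t\<rfloor>))" for t :: real
  have \<psi>_le: "\<psi> s \<le> \<psi> t" if "0 \<le> s" "s \<le> t" for s t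
  proof (cases "s = 0")
    case True
    then show ?thesis using rpos less_imp_le[OF rpos] by (simp add: \<psi>_def)
  next
    case False
    then have "1 / t \<le> 1 / s" using that by (simp add: frac_le)
    then have "nat \<lfloor>1 / t\<rfloor> \<le> nat \<lfloor>1 / s\<rfloor>" by (intro nat_mono floor_mono)
    then show ?thesis using False that rmono by (simp add: \<psi>_def)
  qed
  have \<psi>_0: "\<psi> t = 0 \<longleftrightarrow> t = 0" for t
    using rpos less_irrefl unfolding \<psi>_def by metis
  have \<psi>_nonneg: "0 \<le> \<psi> t" for t
    using less_imp_le[OF rpos] by (simp add: \<psi>_def)
  define e where "e x y = \<psi> (D x y)" for x y
  have pe: "pseudo_ultrametric_on S e"
    unfolding pseudo_ultrametric_on_def
  proof (intro conjI ballI allI impI)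
    fix x y
    show "0 \<le> e x y" by (simp add: e_def \<psi>_nonneg)
    show "e x y = e y x" using pseudo_ultrametric_onD(2)[OF pD, of x y] by (simp add: e_def)
    show "e x x = 0" using pseudo_ultrametric_onD(3)[OF pD, of x] by (simp add: e_def \<psi>_0)
    show "e x y = 0" if "x \<notin> S \<or> y \<notin> S"
      using pseudo_ultrametric_onD(5)[OF pD that] by (simp add: e_def \<psi>_0)
    show "e x y \<le> max (e x z) (e z y)" if "x \<in> S" "y \<in> S" "z \<in> S" for z
    proof -
      have "\<psi> (D x y) \<le> \<psi> (max (D x z) (D z y))"
        by (intro \<psi>_le pseudo_ultrametric_onD(1)[OF pD] pseudo_ultrametric_onD(4)[OF pD that])
      then show ?thesis by (simp add: e_def max_def split: if_splits)
    qed
  qed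
  have "\<forall>x\<in>S. \<forall>y\<in>S. e x y = 0 \<longrightarrow> x = y"
    using D by (simp add: ultrametric_on_def e_def \<psi>_0)
  moreover have "\<forall>x\<in>S. \<forall>y\<in>S. e x y \<in> R"
    using rR characteristic_range_setD(2)[OF R] by (simp add: e_def \<psi>_def)
  moreover have "\<exists>B. \<forall>x\<in>S. \<forall>y\<in>S. e x y \<le> B"
    using rmono[of 0] less_imp_le[OF rpos] by (intro exI[of _ "r 0"]) (simp add: e_def \<psi>_def)
  moreover have "finer_on S D e"
    unfolding finer_on_def
  proof (intro ballI allI impI)
    fix x and \<epsilon> :: real assume "0 < \<epsilon>"
    then obtain n where n: "r n < \<epsilon>" using rlim by blast
    have "e x y < \<epsilon>" if "D x y < 1 / Suc n" for y
    proof -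
      have "\<psi> (D x y) \<le> \<psi> (1 / Suc n)"
        using that pseudo_ultrametric_onD(1)[OF pD] by (intro \<psi>_le) auto
      also have "\<psi> (1 / Suc n) = r (Suc n)"
        by (simp add: \<psi>_def nat_add_distrib)
      finally show ?thesis using rmono[of n "Suc n"] n by (simp add: e_def)
    qed
    then show "\<exists>\<delta>>0. \<forall>y\<in>S. D x y < \<delta> \<longrightarrow> e x y < \<epsilon>"
      by (intro exI[of _ "1 / Suc n"]) auto
  qed
  moreover have "finer_on S e D"
    unfolding finer_on_def
  proof (intro ballI allI impI)
    fix x and \<epsilon> :: real assume "0 < \<epsilon>"
    have "D x y < \<epsilon>" if "e x y < \<psi> \<epsilon>" for y
      using \<psi>_le[of \<epsilon> "D x y"] that \<open>0 < \<epsilon>\<close> by (force simp: e_def not_less[symmetric])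
    moreover have "0 < \<psi> \<epsilon>"
      using \<psi>_nonneg[of \<epsilon>] \<psi>_0[of \<epsilon>] \<open>0 < \<epsilon>\<close> by auto
    ultimately show "\<exists>\<delta>>0. \<forall>y\<in>S. e x y < \<delta> \<longrightarrow> D x y < \<epsilon>" by blast
  qed
  ultimately have "e \<in> UMet_bd X R"
    using D DX pe unfolding S_def by (intro UMet_bdI[of X D])
  then show ?thesis by blast
qed

text \<open>Distances of \<open>d\<close> above \<eta> are kept; within each class of the
  equivalence relation \<open>d x y \<le> \<eta>\<close> the distance becomes \<open>e\<close> cut
  off at \<eta>.\<close>

definition glue :: "('a \<Rightarrow> 'a \<Rightarrow> real) \<Rightarrow> ('a \<Rightarrow> 'a \<Rightarrow> real) \<Rightarrow> real \<Rightarrow> 'a \<Rightarrow> 'a \<Rightarrow> real" where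
  "glue d e \<eta> x y = (if \<eta> < d x y then d x y else min \<eta> (e x y))"

lemma near_glue: "near S \<eta> d (glue d e \<eta>)"
  unfolding near_def glue_def by auto

text \<open>Only small distances decide the topology, and these are those of \<open>e\<close>: near
  any point \<open>d\<close> is below \<eta>, and a glued distance below \<eta> equals the
  \<open>e\<close>-distance.\<close>

lemma glue_in_UMet_bd:
  assumes d: "d \<in> UMet_bd X R" and e: "e \<in> UMet_bd X R" and \<eta>: "\<eta> \<in> R" "0 < \<eta>"
  shows "glue d e \<eta> \<in> UMet_bd X R"
proof -
  define S where "S = topspace X"
  note pd = UMet_bdD(2)[OF d, folded S_def] and pe = UMet_bdD(2)[OF e, folded S_def]
  let ?g = "glue d e \<eta>"
  have "pseudo_ultrametric_on S ?g"
    unfolding pseudo_ultrametric_on_def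
  proof (intro conjI ballI allI impI)
    fix x y
    show "0 \<le> ?g x y"
      using \<eta> pseudo_ultrametric_onD(1)[OF pd, of x y] pseudo_ultrametric_onD(1)[OF pe, of x y]
      by (auto simp: glue_def)
    show "?g x y = ?g y x"
      using pseudo_ultrametric_onD(2)[OF pd, of x y] pseudo_ultrametric_onD(2)[OF pe, of x y]
      by (simp add: glue_def)
    show "?g x x = 0"
      using \<eta> pseudo_ultrametric_onD(3)[OF pd, of x] pseudo_ultrametric_onD(3)[OF pe, of x]
      by (simp add: glue_def)
    show "?g x y = 0" if "x \<notin> S \<or> y \<notin> S"
      using \<eta> pseudo_ultrametric_onD(5)[OF pd that] pseudo_ultrametric_onD(5)[OF pe that]
      by (simp add: glue_def)
    show "?g x y \<le> max (?g x z) (?g z y)" if "x \<in> S" "y \<in> S" "z \<in> S" for z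
      using pseudo_ultrametric_onD(4)[OF pd that] pseudo_ultrametric_onD(4)[OF pe that]
      by (auto simp: glue_def)
  qed
  moreover have "\<forall>x\<in>S. \<forall>y\<in>S. ?g x y = 0 \<longrightarrow> x = y"
    using \<eta> UMet_bdD(1)[OF e] by (auto simp: glue_def ultrametric_on_def S_def min_def split: if_splits)
  moreover have "\<forall>x\<in>S. \<forall>y\<in>S. ?g x y \<in> R"
    using UMet_bdD(3)[OF d] UMet_bdD(3)[OF e] \<eta> by (simp add: glue_def min_def S_def)
  moreover have "\<exists>B. \<forall>x\<in>S. \<forall>y\<in>S. ?g x y \<le> B"
  proof -
    obtain B where "\<forall>x\<in>S. \<forall>y\<in>S. d x y \<le> B"
      using UMet_bdD(4)[OF d] unfolding S_def by blast
    then show ?thesis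
      by (intro exI[of _ "max B \<eta>"]) (auto simp: glue_def le_max_iff_disj)
  qed
  moreover have "finer_on S e ?g"
    unfolding finer_on_def
  proof (intro ballI allI impI)
    fix x and \<epsilon> :: real assume x: "x \<in> S" and "0 < \<epsilon>"
    obtain \<delta> where "0 < \<delta>" "\<forall>y\<in>S. e x y < \<delta> \<longrightarrow> d x y < \<eta>"
      using finer_onE[OF UMet_bd_finer[OF e d], of x \<eta>] x \<eta> unfolding S_def by blast
    then show "\<exists>\<delta>>0. \<forall>y\<in>S. e x y < \<delta> \<longrightarrow> ?g x y < \<epsilon>"
      using \<open>0 < \<epsilon>\<close> by (intro exI[of _ "min \<delta> \<epsilon>"]) (force simp: glue_def)
  qed
  moreover have "finer_on S ?g e"
    unfolding finer_on_def
  proof (intro ballI allI impI)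
    fix x and \<epsilon> :: real assume "0 < \<epsilon>"
    then show "\<exists>\<delta>>0. \<forall>y\<in>S. ?g x y < \<delta> \<longrightarrow> e x y < \<epsilon>"
      using \<eta> by (intro exI[of _ "min \<eta> \<epsilon>"]) (auto simp: glue_def split: if_splits)
  qed
  ultimately show ?thesis
    unfolding S_def by (intro UMet_bdI[OF UMet_bdD(1,5)[OF e]])
qed

text \<open>The level sets \<open>{f = k}\<close> are shrunk to diameter at most \<open>r k\<close>, so that all of \<open>{f \<ge> k}\<close>
  ends up within one ball of radius \<open>r k\<close>.\<close>

definition level_dist ::
  "'a set \<Rightarrow> (nat \<Rightarrow> real) \<Rightarrow> ('a \<Rightarrow> 'a \<Rightarrow> real) \<Rightarrow> ('a \<Rightarrow> nat) \<Rightarrow> 'a \<Rightarrow> 'a \<Rightarrow> real" where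
  "level_dist S r D f x y =
     (if x \<in> S \<and> y \<in> S then if f x = f y then min (D x y) (r (f x)) else r (min (f x) (f y)) else 0)"

text \<open>Local constancy of \<open>f\<close> makes the new distance continuous. Conversely, a
  distance below \<open>r (f x)\<close> forces \<open>f y = f x\<close>, where the new distance is
  \<open>D\<close> cut off.\<close>

lemma level_dist_in_UMet_bd:
  assumes D: "D \<in> UMet_bd X R" and f: "locally_constant_on (topspace X) D f"
    and rR: "\<And>n. r n \<in> R" and rpos: "\<And>n. 0 < r n" and rmono: "\<And>m n. m \<le> n \<Longrightarrow> r n \<le> r m"
  shows "level_dist (topspace X) r D f \<in> UMet_bd X R"
proof -
  define S where "S = topspace X"
  note pD = UMet_bdD(2)[OF D, folded S_def]
  note rnn = less_imp_le[OF rpos]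
  let ?e = "level_dist S r D f"
  have "pseudo_ultrametric_on S ?e"
    unfolding pseudo_ultrametric_on_def
  proof (intro conjI ballI allI impI)
    fix x y
    show "0 \<le> ?e x y"
      using rnn pseudo_ultrametric_onD(1)[OF pD, of x y] by (simp add: level_dist_def)
    show "?e x y = ?e y x"
      using pseudo_ultrametric_onD(2)[OF pD, of x y] by (simp add: level_dist_def min.commute)
    show "?e x x = 0"
      using rnn pseudo_ultrametric_onD(3)[OF pD, of x] by (simp add: level_dist_def)
    show "?e x y = 0" if "x \<notin> S \<or> y \<notin> S"
      using that by (auto simp: level_dist_def)
    show "?e x y \<le> max (?e x z) (?e z y)" if xyz: "x \<in> S" "y \<in> S" "z \<in> S" for z
    proof -
      have e: "?e u v = (if f u = f v then min (D u v) (r (f u)) else r (min (f u) (f v)))"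
        if "u \<in> S" "v \<in> S" for u v
        using that by (simp add: level_dist_def)
      show ?thesis
      proof (cases "f x = f z \<and> f z = f y")
        case True
        then show ?thesis
          using pseudo_ultrametric_onD(4)[OF pD xyz] xyz by (auto simp: e)
      next
        case False
        \<comment> \<open>This holds for pairs within a level and across levels, so it is enough to
          find one leg via \<open>z\<close> that is at least this long.\<close>
        have le: "?e x y \<le> r (min (f x) (f y))"
          using xyz by (simp add: e)
        from False consider "f x \<noteq> f z" "f y \<noteq> f z" | "f x = f z" "f y \<noteq> f z" | "f x \<noteq> f z" "f y = f z"
          by fastforce
        then show ?thesis
        proof cases
          case 1
          have "r (min (f x) (f y)) \<le> max (r (min (f x) (f z))) (r (min (f z) (f y)))"
            using rmono[of "min (f x) (f z)" "f x"] rmono[of "min (f z) (f y)" "f y"]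
            by (cases "f x \<le> f y") (simp_all add: min.absorb1 min.absorb2 le_max_iff_disj)
          then show ?thesis using le 1 xyz by (simp add: e)
        next
          case 2
          then have "?e z y = r (min (f x) (f y))" using xyz by (simp add: e)
          then show ?thesis using le by simp
        next
          case 3
          then have "?e x z = r (min (f x) (f y))" using xyz by (simp add: e)
          then show ?thesis using le by simp
        qed
      qed
    qed
  qed
  moreover have "\<forall>x\<in>S. \<forall>y\<in>S. ?e x y = 0 \<longrightarrow> x = y"
  proof (intro ballI impI)
    fix x y assume "x \<in> S" "y \<in> S" "?e x y = 0"
    then have "D x y = 0"
      using rpos[of "f x"] rpos[of "min (f x) (f y)"] by (simp add: level_dist_def min_def split: if_splits)
    then show "x = y"
      using UMet_bdD(1)[OF D] \<open>x \<in> S\<close> \<open>y \<in> S\<close> by (simp add: ultrametric_on_def S_def)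
  qed
  moreover have "\<forall>x\<in>S. \<forall>y\<in>S. ?e x y \<in> R"
    using UMet_bdD(3)[OF D] rR by (simp add: level_dist_def min_def S_def)
  moreover have "\<exists>B. \<forall>x\<in>S. \<forall>y\<in>S. ?e x y \<le> B"
    using rmono[of 0] by (intro exI[of _ "r 0"]) (simp add: level_dist_def min.coboundedI2)
  moreover have "finer_on S D ?e"
    unfolding finer_on_def
  proof (intro ballI allI impI)
    fix x and \<epsilon> :: real assume x: "x \<in> S" and "0 < \<epsilon>"
    obtain \<delta> where \<delta>: "0 < \<delta>" "\<And>y. y \<in> S \<Longrightarrow> D x y < \<delta> \<Longrightarrow> f y = f x"
      using locally_constant_onE[OF f] x unfolding S_def by blast
    have "?e x y < \<epsilon>" if "y \<in> S" "D x y < min \<delta> \<epsilon>" for y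
    proof -
      have "f y = f x" using that by (intro \<delta>(2)) auto
      then show ?thesis using x that by (simp add: level_dist_def min.strict_coboundedI1)
    qed
    then show "\<exists>\<delta>>0. \<forall>y\<in>S. D x y < \<delta> \<longrightarrow> ?e x y < \<epsilon>"
      using \<delta>(1) \<open>0 < \<epsilon>\<close> by (intro exI[of _ "min \<delta> \<epsilon>"]) simp
  qed
  moreover have "finer_on S ?e D"
    unfolding finer_on_def
  proof (intro ballI allI impI)
    fix x and \<epsilon> :: real assume x: "x \<in> S" and "0 < \<epsilon>"
    have "D x y < \<epsilon>" if "y \<in> S" "?e x y < min (r (f x)) \<epsilon>" for y
    proof (cases "f x = f y")
      case True
      then show ?thesis using x that by (auto simp: level_dist_def)
    next
      case False
      then have "?e x y \<ge> r (f x)" using x that rmono[of "min (f x) (f y)" "f x"] by (simp add: level_dist_def)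
      then show ?thesis using that by simp
    qed
    then show "\<exists>\<delta>>0. \<forall>y\<in>S. ?e x y < \<delta> \<longrightarrow> D x y < \<epsilon>"
      using \<open>0 < \<epsilon>\<close> rpos by (intro exI[of _ "min (r (f x)) \<epsilon>"]) simp
  qed
  ultimately show ?thesis
    unfolding S_def by (intro UMet_bdI[OF UMet_bdD(1,5)[OF D]])
qed

lemma level_dist_le:
  assumes "\<And>m n. m \<le> n \<Longrightarrow> r n \<le> r m" "0 \<le> r k" "k \<le> f x" "k \<le> f y"
  shows "level_dist S r D f x y \<le> r k"
proof -
  have "r (f x) \<le> r k" "r (min (f x) (f y)) \<le> r k"
    using assms by auto
  then show ?thesis
    using assms(2) by (auto simp: level_dist_def intro: min.coboundedI2)
qed

lemma (in Metric_space) MCauchy_geometric: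
  assumes M: "range \<sigma> \<subseteq> M" and step: "\<And>n. d (\<sigma> n) (\<sigma> (Suc n)) < (1/2) ^ n"
  shows "MCauchy \<sigma>"
proof -
  have \<sigma>: "\<sigma> n \<in> M" for n using M by blast
  \<comment> \<open>The exact value of the geometric sum is used so that the induction
    closes.\<close>
  have le: "d (\<sigma> n) (\<sigma> (n + m)) \<le> 2 * (1/2) ^ n - 2 * (1/2) ^ (n + m)" for n m
  proof (induction m)
    case 0
    then show ?case using \<sigma> by simp
  next
    case (Suc m)
    have "d (\<sigma> n) (\<sigma> (n + Suc m)) \<le> d (\<sigma> n) (\<sigma> (n + m)) + d (\<sigma> (n + m)) (\<sigma> (Suc (n + m)))"
      using triangle[OF \<sigma> \<sigma> \<sigma>] by simp
    also have "\<dots> \<le> 2 * (1/2) ^ n - 2 * (1/2) ^ (n + m) + (1/2) ^ (n + m)"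
      using Suc step[of "n + m"] by linarith
    finally show ?case by simp
  qed
  have lt: "d (\<sigma> n) (\<sigma> m) < 2 * (1/2) ^ N" if "N \<le> n" "n \<le> m" for n m N
  proof -
    have "d (\<sigma> n) (\<sigma> m) < 2 * (1/2) ^ n"
    proof -
      have "0 < (1/2::real) ^ m" by simp
      moreover have "d (\<sigma> n) (\<sigma> m) \<le> 2 * (1/2) ^ n - 2 * (1/2) ^ m"
        using le[of n "m - n"] that(2) by simp
      ultimately show ?thesis by linarith
    qed
    moreover have "(1/2::real) ^ n \<le> (1/2) ^ N"
      using that(1) by (simp add: power_decreasing)
    ultimately show ?thesis by linarith
  qed
  show ?thesis
    unfolding MCauchy_def
  proof (intro conjI allI impI)
    fix \<epsilon> :: real assume "0 < \<epsilon>"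
    then obtain N where N: "(1/2::real) ^ N < \<epsilon> / 2"
      using real_arch_pow_inv[of "\<epsilon> / 2" "1/2"] by auto
    have "d (\<sigma> n) (\<sigma> m) < \<epsilon>" if "N \<le> n" "N \<le> m" for n m
      using lt[of N n m] lt[of N m n] commute[of "\<sigma> n" "\<sigma> m"] that N by (cases "n \<le> m") auto
    then show "\<exists>N. \<forall>n n'. N \<le> n \<longrightarrow> N \<le> n' \<longrightarrow> d (\<sigma> n) (\<sigma> n') < \<epsilon>" by blast
  qed (fact M)
qed

section \<open>A winning strategy from a complete metric\<close>

text \<open>If \<open>x\<close> escaped every bound, then for each \<open>n\<close> all points \<open>z\<close> with \<open>g z\<close> large would satisfy
  \<open>d n x z \<le> \<eta> n\<close>. Since \<open>\<eta> n \<rightarrow> 0\<close>, the limit of the \<open>d n\<close> would make \<open>x\<close> a limit of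
  points on which \<open>g\<close> is unbounded.\<close>

lemma completely_metrizable_imp_game_strategy:
  fixes X :: "'a topology" and g :: "'a \<Rightarrow> nat"
  assumes R: "characteristic_range_set R" and D: "D \<in> UMet_bd X R"
    and cm: "completely_metrizable_space (UMet_bd_topology X R)"
    and g: "locally_constant_on (topspace X) D g" and unb: "\<And>b. \<exists>z\<in>topspace X. b < g z"
  obtains s\<^sub>0 :: "nat \<times> ('a \<Rightarrow> 'a \<Rightarrow> real) \<times> real" and step bound where
    "\<And>st f x. st 0 = s\<^sub>0 \<Longrightarrow> (\<And>n. st (Suc n) = step (st n) (f n)) \<Longrightarrow>
      (\<And>n. f n \<in> {f. locally_constant_on (topspace X) D f \<and> (\<forall>x\<in>topspace X. g x \<le> f x)}) \<Longrightarrow>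
      x \<in> topspace X \<Longrightarrow> \<exists>n. f n x < bound (st (Suc n))"
proof -
  define S where "S = topspace X"
  define U where "U = UMet_bd X R"
  let ?T = "UMet_bd_topology X R"
  obtain M \<rho> where M: "Metric_space M \<rho>" and complete: "Metric_space.mcomplete M \<rho>"
    and T: "?T = Metric_space.mtopology M \<rho>"
    using cm unfolding completely_metrizable_space_def by blast
  interpret Metric_space M \<rho> by (rule M)
  have MU: "M = U"
    using topspace_UMet_bd_topology[OF R, of X] unfolding T U_def by simp
  note openT = openin_UMet_bd_topology[OF R, of X, folded S_def U_def, unfolded T]
  obtain r :: "nat \<Rightarrow> real" where rR: "\<And>n. r n \<in> R" and rpos: "\<And>n. 0 < r n"
    and rmono: "\<And>m n. m \<le> n \<Longrightarrow> r n \<le> r m" and rlim: "\<And>\<epsilon>. 0 < \<epsilon> \<Longrightarrow> \<exists>n. r n < \<epsilon>"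
    by (rule characteristic_range_set_seq[OF R]) (rule that)
  have pos: "0 < \<delta>" if "\<delta> \<in> R - {0}" for \<delta>
    using that characteristic_range_setD(1)[OF R] by force
  \<comment> \<open>Admissible next scales: so small that a change of \<open>d\<close> at that scale
    moves it by less than \<open>(1/2) ^ n\<close> in the complete metric \<rho>.\<close>
  define P where "P n d \<eta> \<delta> \<longleftrightarrow> \<delta> \<in> R - {0} \<and> \<delta> < \<eta> \<and> \<delta> < 1 / Suc n \<and>
    (\<forall>e\<in>U. near S \<delta> d e \<longrightarrow> \<rho> d e < (1/2) ^ n)" for n d \<eta> \<delta>
  have exP: "\<exists>\<delta>. P n d \<eta> \<delta>" if d: "d \<in> U" and \<eta>: "0 < \<eta>" for n d \<eta>
  proof -
    have "openin mtopology (mball d ((1/2) ^ n))" by simp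
    moreover have "d \<in> mball d ((1/2) ^ n)" using d[folded MU] by simp
    ultimately obtain \<delta> where \<delta>: "\<delta> \<in> R - {0}" "\<forall>e\<in>U. near S \<delta> d e \<longrightarrow> e \<in> mball d ((1/2) ^ n)"
      unfolding openT by meson
    obtain \<gamma> where \<gamma>: "\<gamma> \<in> R - {0}" "\<gamma> < min \<delta> (min \<eta> (1 / Suc n))"
      using characteristic_range_setD(3)[OF R, of "min \<delta> (min \<eta> (1 / Suc n))"] pos[OF \<delta>(1)] \<eta> by auto
    have "near S \<delta> d e" if "near S \<gamma> d e" for e
      by (rule near_mono[OF that]) (use \<gamma>(2) in simp)
    then have "\<forall>e\<in>U. near S \<gamma> d e \<longrightarrow> \<rho> d e < (1/2) ^ n"
      using \<delta>(2) by auto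
    then show ?thesis using \<gamma> by (auto simp: P_def)
  qed
  \<comment> \<open>A position holds the round, the current ultrametric and the current scale. The
    move \<open>f\<close> alters the ultrametric only up to the scale \<eta>; then a finer scale is
    chosen for the result.\<close>
  define step where "step s f = (case s of (n, d, \<eta>) \<Rightarrow>
      let d' = glue d (level_dist S r D f) \<eta> in (Suc n, d', SOME \<delta>. P n d' \<eta> \<delta>))"
    for s :: "nat \<times> ('a \<Rightarrow> 'a \<Rightarrow> real) \<times> real" and f
  \<comment> \<open>TWO's answer is an index \<open>k\<close> for which \<open>{f \<ge> k}\<close>
    has been shrunk below the new scale.\<close>
  define bound where "bound s = (SOME k. r k < snd (snd s))"
    for s :: "nat \<times> ('a \<Rightarrow> 'a \<Rightarrow> real) \<times> real"
  \<comment> \<open>The initial ultrametric is \<open>D\<close> cut off at \<open>r 0\<close>, so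
    all its distances are within the initial scale.\<close>
  define s\<^sub>0 where "s\<^sub>0 = (0 :: nat, level_dist S (\<lambda>n. r 0) D (\<lambda>x. 0), r 0)"
  have "\<exists>n. f n x < bound (st (Suc n))"
    if st0: "st 0 = s\<^sub>0" and stSuc: "\<And>n. st (Suc n) = step (st n) (f n)"
      and f: "\<And>n. f n \<in> {f. locally_constant_on S D f \<and> (\<forall>x\<in>S. g x \<le> f x)}"
      and x: "x \<in> S" for st f x
  proof (rule ccontr)
    assume "\<not> ?thesis"
    then have big: "bound (st (Suc n)) \<le> f n x" for n by (simp add: not_less)
    define d where "d n = fst (snd (st n))" for n
    define \<eta> where "\<eta> n = snd (snd (st n))" for n
    define lev where "lev n = level_dist S r D (f n)" for n
    have fst_st: "fst (st n) = n" for n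
      by (induction n) (auto simp: st0 s\<^sub>0_def stSuc step_def Let_def split: prod.split)
    have st: "st n = (n, d n, \<eta> n)" for n
      using fst_st[of n] by (simp add: d_def \<eta>_def prod_eq_iff)
    have d0: "d 0 = level_dist S (\<lambda>n. r 0) D (\<lambda>x. 0)" and \<eta>0: "\<eta> 0 = r 0"
      by (simp_all add: d_def \<eta>_def st0 s\<^sub>0_def)
    have "st (Suc n) = (Suc n, glue (d n) (lev n) (\<eta> n), SOME \<delta>. P n (glue (d n) (lev n) (\<eta> n)) (\<eta> n) \<delta>)" for n
      unfolding stSuc st[of n] by (simp add: step_def Let_def lev_def)
    then have dSuc: "d (Suc n) = glue (d n) (lev n) (\<eta> n)"
      and \<eta>Suc: "\<eta> (Suc n) = (SOME \<delta>. P n (d (Suc n)) (\<eta> n) \<delta>)" for n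
      by (simp_all add: d_def[of "Suc n"] \<eta>_def[of "Suc n"])
    have lev: "lev n \<in> U" for n
      using f[of n] level_dist_in_UMet_bd[OF D _ rR rpos rmono] by (simp add: lev_def U_def S_def)
    have d0U: "d 0 \<in> U"
      unfolding d0 U_def S_def
      by (rule level_dist_in_UMet_bd[OF D]) (auto simp: rR rpos locally_constant_on_def intro: exI[of _ 1])
    have inv: "d n \<in> U \<and> \<eta> n \<in> R - {0}" for n
    proof (induction n)
      case 0
      then show ?case using d0U rR rpos[of 0] by (simp add: \<eta>0)
    next
      case (Suc n)
      then have "d (Suc n) \<in> U"
        unfolding dSuc U_def using lev[of n] pos by (intro glue_in_UMet_bd) (auto simp: U_def)
      moreover from this have "P n (d (Suc n)) (\<eta> n) (\<eta> (Suc n))"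
        unfolding \<eta>Suc using exP Suc pos by (intro someI_ex[of "P n (d (Suc n)) (\<eta> n)"]) blast
      ultimately show ?case by (simp add: P_def)
    qed
    then have dU: "\<And>n. d n \<in> U" and \<eta>R: "\<And>n. \<eta> n \<in> R - {0}" by auto
    have P: "P n (d (Suc n)) (\<eta> n) (\<eta> (Suc n))" for n
      unfolding \<eta>Suc using exP dU \<eta>R pos by (intro someI_ex[of "P n (d (Suc n)) (\<eta> n)"]) blast
    have \<eta>_less: "\<eta> (Suc n) < \<eta> n" "\<eta> (Suc n) < 1 / Suc n" for n
      using P[of n] by (auto simp: P_def)
    have \<eta>_antimono: "\<eta> m \<le> \<eta> n" if "n \<le> m" for n m
      using lift_Suc_antimono_le[of \<eta> n m] \<eta>_less(1) that by (simp add: less_imp_le)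
    have near_Suc: "near S (\<eta> n) (d n) (d (Suc n))" for n
      unfolding dSuc by (rule near_glue)
    have near_d: "near S (\<eta> n) (d n) (d (n + m))" for n m
    proof (induction m)
      case 0
      then show ?case by (simp add: near_refl)
    next
      case (Suc m)
      have "near S (\<eta> n) (d (n + m)) (d (Suc (n + m)))"
        by (rule near_mono[OF near_Suc \<eta>_antimono]) simp
      then show ?case using near_trans[OF Suc] by simp
    qed
    \<comment> \<open>\<open>P n\<close> concerns \<open>d (Suc n)\<close> and the scale chosen for
      it, so the estimate starts at \<open>d (Suc n)\<close>; the Cauchy sequence is shifted
      accordingly.\<close>
    have "\<rho> (d (Suc n)) (d (Suc (Suc n))) < (1/2) ^ n" for n
      using P[of n] near_Suc[of "Suc n"] dU by (simp add: P_def)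
    then have "MCauchy (\<lambda>n. d (Suc n))"
      using dU by (intro MCauchy_geometric) (auto simp: MU)
    then obtain l where l: "limitin mtopology (\<lambda>n. d (Suc n)) l sequentially"
      using complete unfolding mcomplete_def by blast
    then have lU: "l \<in> U" using limitin_mspace MU by auto
    \<comment> \<open>Only the topology links \<rho> with nearness: the class of \<open>l\<close> at
      threshold \<open>\<eta> n\<close> is open, hence contains a tail of the sequence.\<close>
    have near_l: "near S (\<eta> n) (d n) l" for n
    proof -
      let ?V = "{e \<in> U. near S (\<eta> n) l e}"
      have "openin mtopology ?V"
        unfolding openT
      proof (intro conjI ballI)
        fix e assume "e \<in> ?V"
        then show "\<exists>\<delta>\<in>R - {0}. \<forall>e'\<in>U. near S \<delta> e e' \<longrightarrow> e' \<in> ?V"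
          using near_trans by (intro bexI[OF _ \<eta>R[of n]]) blast
      qed auto
      moreover have "l \<in> ?V" using lU near_refl by simp
      ultimately have "\<forall>\<^sub>F m in sequentially. d (Suc m) \<in> ?V"
        using l unfolding limitin_def by blast
      then obtain N where "\<And>m. N \<le> m \<Longrightarrow> d (Suc m) \<in> ?V"
        unfolding eventually_sequentially by blast
      from this[of "n + N"] have "near S (\<eta> n) l (d (n + Suc N))" by simp
      then show ?thesis using near_trans[OF near_d near_sym] by blast
    qed
    have J: "\<exists>J. \<forall>z\<in>S. J \<le> g z \<longrightarrow> d n x z \<le> \<eta> n" for n
    proof (induction n)
      case 0
      show ?case using rpos[of 0] by (auto simp: d0 \<eta>0 level_dist_def)
    next
      case (Suc n)
      then obtain J where J: "\<forall>z\<in>S. J \<le> g z \<longrightarrow> d n x z \<le> \<eta> n" by blast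
      define k where "k = bound (st (Suc n))"
      have k: "r k < \<eta> (Suc n)"
        unfolding k_def bound_def \<eta>_def[symmetric] using rlim[OF pos[OF \<eta>R]] by (rule someI_ex)
      \<comment> \<open>Both \<open>x\<close> and \<open>z\<close> lie in
        \<open>{f n \<ge> k}\<close>, for \<open>z\<close> because \<open>f n\<close> dominates
        \<open>g\<close>. As \<open>d n x z \<le> \<eta> n\<close>, gluing uses the shrunk
        distance.\<close>
      have "d (Suc n) x z \<le> \<eta> (Suc n)" if z: "z \<in> S" "max J k \<le> g z" for z
      proof -
        have "k \<le> f n z" using f[of n] z by fastforce
        then have "lev n x z \<le> r k"
          unfolding lev_def using big[of n] rpos[of k] rmono by (intro level_dist_le) (auto simp: k_def)
        moreover have "d n x z \<le> \<eta> n" using J z by simp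
        ultimately show ?thesis using k by (simp add: dSuc[of n] glue_def)
      qed
      then show ?case by blast
    qed
    obtain \<delta> where \<delta>: "0 < \<delta>" "\<And>y. y \<in> S \<Longrightarrow> D x y < \<delta> \<Longrightarrow> g y = g x"
      using locally_constant_onE[OF g] x unfolding S_def by blast
    obtain \<gamma> where \<gamma>: "0 < \<gamma>" "\<forall>y\<in>S. l x y < \<gamma> \<longrightarrow> D x y < \<delta>"
      using finer_onE[OF UMet_bd_finer[OF lU[unfolded U_def] D] _ \<delta>(1)] x unfolding S_def by blast
    obtain n where n: "1 / Suc n < \<gamma>" using nat_approx_posE[OF \<gamma>(1)] by blast
    obtain J where J: "\<forall>z\<in>S. J \<le> g z \<longrightarrow> d (Suc n) x z \<le> \<eta> (Suc n)" using J by blast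
    obtain z where z: "z \<in> S" "max J (g x) < g z" using unb[of "max J (g x)"] by (auto simp: S_def)
    have "l x z \<le> max (d (Suc n) x z) (\<eta> (Suc n))"
      using nearD(2)[OF near_l x z(1)] .
    moreover have "d (Suc n) x z \<le> \<eta> (Suc n)" using J z by simp
    ultimately have "l x z < \<gamma>" using \<eta>_less(2)[of n] n by linarith
    then have "g z = g x" using \<gamma>(2) z(1) by (intro \<delta>(2)) auto
    then show False using z by simp
  qed
  then show thesis
    unfolding S_def by (rule that[of s\<^sub>0 step bound])
qed

section \<open>From the winning strategy to \<sigma>-compactness\<close>

lemma completely_metrizable_imp_small:
  fixes X :: "'a topology" and g :: "'a \<Rightarrow> nat"
  assumes R: "characteristic_range_set R" and D: "D \<in> UMet_bd X R"
    and cm: "completely_metrizable_space (UMet_bd_topology X R)"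
    and g: "locally_constant_on (topspace X) D g" and unb: "\<And>b. \<exists>z\<in>topspace X. b < g z"
    and cover: "\<And>k. \<exists>C\<subseteq>{f. locally_constant_on (topspace X) D f \<and> (\<forall>x\<in>topspace X. g x \<le> f x)}.
      countable C \<and> {x \<in> topspace X. \<forall>f\<in>C. f x < k f} \<in> \<I>"
    and Un: "\<And>\<A>. countable \<A> \<Longrightarrow> \<A> \<subseteq> \<I> \<Longrightarrow> \<Union>\<A> \<in> \<I>"
  shows "\<exists>A\<in>\<I>. topspace X \<subseteq> A"
proof (rule completely_metrizable_imp_game_strategy[OF R D cm g unb])
  fix s\<^sub>0 :: "nat \<times> ('a \<Rightarrow> 'a \<Rightarrow> real) \<times> real" and step bound
  assume win: "\<And>st f x. st 0 = s\<^sub>0 \<Longrightarrow> (\<And>n. st (Suc n) = step (st n) (f n)) \<Longrightarrow>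
      (\<And>n. f n \<in> {f. locally_constant_on (topspace X) D f \<and> (\<forall>x\<in>topspace X. g x \<le> f x)}) \<Longrightarrow>
      x \<in> topspace X \<Longrightarrow> \<exists>n. f n x < bound (st (Suc n))"
  \<comment> \<open>The strategy disappears here. What remains is a family \<open>\<I>\<close>
    closed under countable unions, chosen below once for separability and once for
    \<sigma>-compactness.\<close>
  show ?thesis
    by (rule covering_game_winning_imp_small[where step = step and bound = bound])
      (fact win, fact cover, fact Un)
qed

text \<open>Balls of equal radius are disjoint or equal, so functions on an uncountable set
  \<open>Q\<close> of them become locally constant functions on the space. For the ideal of sets
  whose points centre only countably many balls in \<open>Q\<close>, the game would make
  \<open>Q\<close> countable.\<close>

lemma completely_metrizable_imp_countable_balls:
  assumes R: "characteristic_range_set R" and D: "D \<in> UMet_bd X R"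
    and cm: "completely_metrizable_space (UMet_bd_topology X R)"
    and g: "locally_constant_on (topspace X) D g" and unb: "\<And>b. \<exists>z\<in>topspace X. b < g z"
    and c: "0 < c"
  shows "countable ((\<lambda>x. {y \<in> topspace X. D x y < c}) ` topspace X)"
proof (rule ccontr)
  define S where "S = topspace X"
  define B where "B x = {y \<in> S. D x y < c}" for x
  let ?F = "{f. locally_constant_on S D f \<and> (\<forall>x\<in>S. g x \<le> f x)}"
  assume "\<not> countable ((\<lambda>x. {y \<in> topspace X. D x y < c}) ` topspace X)"
  then have unc: "uncountable (B ` S)" by (simp add: B_def S_def)
  obtain Q where Q: "Q \<subseteq> B ` S" "uncountable Q"
    and Qk: "\<And>k :: ('a set \<Rightarrow> nat) \<Rightarrow> nat. \<exists>C. countable C \<and> countable {q \<in> Q. \<forall>\<phi>\<in>C. \<phi> q < k \<phi>}"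
    by (rule uncountable_imp_unbounded_functions[OF unc]) (rule that)
  \<comment> \<open>Moves must dominate \<open>g\<close>; the maximum ensures this and only shrinks
    the set on which a bound holds.\<close>
  define lift where "lift \<phi> = (\<lambda>x. max (\<phi> (B x)) (g x))" for \<phi>
  have lc: "locally_constant_on S D (\<lambda>x. \<phi> (B x))" for \<phi>
    unfolding locally_constant_on_def
  proof
    fix x assume "x \<in> S"
    then have "B y = B x" if "y \<in> S" "D x y < c" for y
      using ultrametric_ball_eq[OF UMet_bdD(2)[OF D]] that unfolding B_def S_def by blast
    then have "\<forall>y\<in>S. D x y < c \<longrightarrow> \<phi> (B y) = \<phi> (B x)" by metis
    then show "\<exists>\<delta>>0. \<forall>y\<in>S. D x y < \<delta> \<longrightarrow> \<phi> (B y) = \<phi> (B x)" using c by blast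
  qed
  have lift: "lift \<phi> \<in> ?F" for \<phi>
    using locally_constant_on_max[OF lc] g by (simp add: lift_def S_def)
  let ?\<I> = "{A. countable (B ` A \<inter> Q)}"
  have "\<exists>A\<in>?\<I>. S \<subseteq> A"
    unfolding S_def
  proof (rule completely_metrizable_imp_small[OF R D cm g unb], fold S_def)
    fix k
    obtain C where C: "countable C" "countable {q \<in> Q. \<forall>\<phi>\<in>C. \<phi> q < k (lift \<phi>)}"
      using Qk[of "\<lambda>\<phi>. k (lift \<phi>)"] by blast
    have "B ` {x \<in> S. \<forall>f\<in>lift ` C. f x < k f} \<inter> Q \<subseteq> {q \<in> Q. \<forall>\<phi>\<in>C. \<phi> q < k (lift \<phi>)}"
      by (auto simp: lift_def)
    then have "countable (B ` {x \<in> S. \<forall>f\<in>lift ` C. f x < k f} \<inter> Q)"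
      using C(2) by (rule countable_subset)
    then show "\<exists>C\<subseteq>?F. countable C \<and> {x \<in> S. \<forall>f\<in>C. f x < k f} \<in> ?\<I>"
      using C(1) lift by (intro exI[of _ "lift ` C"]) blast
  next
    fix \<A> :: "'a set set" assume \<A>: "countable \<A>" "\<A> \<subseteq> ?\<I>"
    have "B ` \<Union>\<A> \<inter> Q = (\<Union>A\<in>\<A>. B ` A \<inter> Q)" by blast
    moreover have "countable (\<Union>A\<in>\<A>. B ` A \<inter> Q)" using \<A> by (intro countable_UN) auto
    ultimately show "\<Union>\<A> \<in> ?\<I>" by simp
  qed
  then obtain A where A: "countable (B ` A \<inter> Q)" "S \<subseteq> A" by blast
  have "Q \<subseteq> B ` A \<inter> Q" using Q(1) A(2) by blast
  then show False using A(1) Q(2) countable_subset by blast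
qed

lemma second_countable_if_countable_balls:
  assumes "Metric_space S D" and "\<And>c. 0 < c \<Longrightarrow> countable ((\<lambda>x. {y \<in> S. D x y < c}) ` S)"
  shows "second_countable (Metric_space.mtopology S D)"
proof -
  interpret Metric_space S D by fact
  define \<B> where "\<B> = (\<Union>n. (\<lambda>x. mball x (1 / Suc n)) ` S)"
  have "countable ((\<lambda>x. mball x (1 / Suc n)) ` S)" for n
  proof -
    have "mball x (1 / Suc n) = {y \<in> S. D x y < 1 / Suc n}" if "x \<in> S" for x
      using that by auto
    then have "(\<lambda>x. mball x (1 / Suc n)) ` S = (\<lambda>x. {y \<in> S. D x y < 1 / Suc n}) ` S"
      by (rule image_cong[OF refl])
    then show ?thesis using assms(2)[of "1 / Suc n"] by simp
  qed
  then have "countable \<B>" by (simp add: \<B>_def)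
  moreover have "\<forall>V\<in>\<B>. openin mtopology V" by (auto simp: \<B>_def)
  moreover have "\<exists>V\<in>\<B>. x \<in> V \<and> V \<subseteq> U" if U: "openin mtopology U" "x \<in> U" for U x
  proof -
    obtain \<epsilon> where \<epsilon>: "0 < \<epsilon>" "mball x \<epsilon> \<subseteq> U" using U unfolding openin_mtopology by blast
    obtain n where n: "1 / Suc n < \<epsilon>" using nat_approx_posE[OF \<epsilon>(1)] by blast
    have x: "x \<in> S" using U openin_mtopology by blast
    have "mball x (1 / Suc n) \<subseteq> U" using \<epsilon>(2) n mball_subset_concentric[of "1 / Suc n" \<epsilon> x] by auto
    moreover have "x \<in> mball x (1 / Suc n)" using x by simp
    moreover have "mball x (1 / Suc n) \<in> \<B>" using x by (auto simp: \<B>_def)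
    ultimately show ?thesis by blast
  qed
  ultimately show ?thesis unfolding second_countable_def by blast
qed

lemma completely_metrizable_imp_sigma_compact:
  assumes R: "characteristic_range_set R" and X: "ultrametrizable_space X"
    and cm: "completely_metrizable_space (UMet_bd_topology X R)"
  shows "sigma_compact_space X"
proof (cases "compactin X (topspace X)")
  case True
  then show ?thesis
    unfolding sigma_compact_space_def by (intro exI[of _ "{topspace X}"]) simp
next
  case False
  define S where "S = topspace X"
  obtain D where D: "D \<in> UMet_bd X R" using UMet_bd_nonempty[OF R X] by blast
  have uD: "ultrametric_on S D" and DX: "Metric_space.mtopology S D = X"
    using UMet_bdD(1,5)[OF D] by (simp_all add: S_def)
  have pD: "pseudo_ultrametric_on S D" using uD by (simp add: ultrametric_on_def)
  have compactI: "compactin X K"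
    if "closedin X K" "\<And>f. locally_constant_on S D f \<Longrightarrow> \<exists>b. \<forall>x\<in>K. f x \<le> b" for K
    using compactin_if_locally_constant_bounded[OF uD] that unfolding DX by blast
  \<comment> \<open>This supplies the unbounded function that the game requires, and is the reason
    for treating compact \<open>X\<close> separately.\<close>
  have "\<exists>g. locally_constant_on S D g \<and> \<not> (\<exists>b. \<forall>x\<in>S. g x \<le> b)"
  proof (rule ccontr)
    assume "\<not> ?thesis"
    then have "compactin X S"
      by (intro compactI) (auto simp: S_def)
    then show False using False by (simp add: S_def)
  qed
  then obtain g where g: "locally_constant_on S D g" and "\<not> (\<exists>b. \<forall>x\<in>S. g x \<le> b)" by blast
  then have unb: "\<exists>x\<in>S. b < g x" for b
    by (meson not_le)
  have "second_countable X"
    unfolding DX[symmetric]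
  proof (rule second_countable_if_countable_balls[OF ultrametric_on_Metric_space[OF uD]])
    show "countable ((\<lambda>x. {y \<in> S. D x y < c}) ` S)" if "0 < c" for c
      unfolding S_def
      by (rule completely_metrizable_imp_countable_balls[OF R D cm g[unfolded S_def] unb[unfolded S_def] that])
  qed
  \<comment> \<open>The Lindelof property is needed for subspaces, which second countability passes
    to.\<close>
  then have Lin: "Lindelof_space (subtopology X A)" for A
    by (intro second_countable_imp_Lindelof_space second_countable_subtopology)
  let ?F = "{f. locally_constant_on S D f \<and> (\<forall>x\<in>S. g x \<le> f x)}"
  let ?\<I> = "{A. \<exists>\<K>. countable \<K> \<and> (\<forall>K\<in>\<K>. compactin X K) \<and> A \<subseteq> \<Union>\<K>}"
  have "\<exists>A\<in>?\<I>. S \<subseteq> A"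
    unfolding S_def
  proof (rule completely_metrizable_imp_small[OF R D cm g[unfolded S_def] unb[unfolded S_def]], fold S_def)
    fix k :: "('a \<Rightarrow> nat) \<Rightarrow> nat"
    \<comment> \<open>Quantifying over all moves makes every locally constant function bounded on
      \<open>K\<close>; a countable set of moves is extracted only afterwards.\<close>
    define K where "K = {x \<in> S. \<forall>f\<in>?F. f x < k f}"
    define V where "V f = {x \<in> S. \<not> f x < k f}" for f
    have V: "openin X (V f)" if "f \<in> ?F" for f
      using openin_locally_constant_on[OF ultrametric_on_Metric_space[OF uD], of f "\<lambda>n. \<not> n < k f"] that
      unfolding DX V_def by blast
    have VK: "S - K = \<Union>(V ` ?F)"
      unfolding K_def V_def by blast
    have "openin X (S - K)"
      unfolding VK using V by (intro openin_Union) blast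
    then have "closedin X K"
      unfolding closedin_def S_def[symmetric] by (simp add: K_def)
    then have "compactin X K"
    proof (rule compactI)
      fix f assume "locally_constant_on S D f"
      \<comment> \<open>The maximum with \<open>g\<close> turns an arbitrary locally constant
        function into a legal move, whose bound also bounds \<open>f\<close> on
        \<open>K\<close>.\<close>
      then have fg: "(\<lambda>x. max (f x) (g x)) \<in> ?F" (is "?h \<in> _")
        using locally_constant_on_max[OF _ g] by simp
      have "f x \<le> k ?h" if "x \<in> K" for x
      proof -
        have "\<forall>f\<in>?F. f x < k f" using that by (simp add: K_def)
        from bspec[OF this fg] show ?thesis by simp
      qed
      then show "\<exists>b. \<forall>x\<in>K. f x \<le> b" by blast
    qed
    \<comment> \<open>The open sets \<open>V f\<close> cover the complement of \<open>K\<close>. By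
      the Lindelof property countably many do, so the corresponding moves already cut out
      \<open>K\<close>.\<close>
    moreover have "\<exists>C\<subseteq>?F. countable C \<and> S - K \<subseteq> \<Union>(V ` C)"
    proof -
      have SK: "S - K \<subseteq> topspace X" by (auto simp: S_def)
      have "(\<forall>U\<in>V ` ?F. openin X U) \<and> S - K \<subseteq> \<Union>(V ` ?F)"
        unfolding VK using V by blast
      from Lin[of "S - K", unfolded Lindelof_space_subtopology_subset[OF SK], rule_format, OF this]
      obtain \<V> where \<V>: "countable \<V>" "\<V> \<subseteq> V ` ?F" "S - K \<subseteq> \<Union>\<V>" by blast
      obtain C where "countable C" "C \<subseteq> ?F" "\<V> = V ` C"
        using countable_subset_image[of \<V> V ?F] \<V>(1,2) by blast
      then show ?thesis using \<V>(3) by blast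
    qed
    then obtain C where C: "C \<subseteq> ?F" "countable C" "S - K \<subseteq> \<Union>(V ` C)" by blast
    have "{x \<in> S. \<forall>f\<in>C. f x < k f} \<subseteq> \<Union>{K}"
      using C(3) by (auto simp: V_def)
    ultimately have "{x \<in> S. \<forall>f\<in>C. f x < k f} \<in> ?\<I>"
      by (intro CollectI exI[of _ "{K}"]) simp
    then show "\<exists>C\<subseteq>?F. countable C \<and> {x \<in> S. \<forall>f\<in>C. f x < k f} \<in> ?\<I>"
      using C(1,2) by blast
  next
    fix \<A> :: "'a set set" assume \<A>: "countable \<A>" "\<A> \<subseteq> ?\<I>"
    then have "\<forall>A\<in>\<A>. \<exists>\<K>. countable \<K> \<and> (\<forall>K\<in>\<K>. compactin X K) \<and> A \<subseteq> \<Union>\<K>" by blast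
    then obtain \<kappa> where \<kappa>: "\<forall>A\<in>\<A>. countable (\<kappa> A) \<and> (\<forall>K\<in>\<kappa> A. compactin X K) \<and> A \<subseteq> \<Union>(\<kappa> A)"
      by (rule bchoice[THEN exE])
    have "countable (\<Union>(\<kappa> ` \<A>))" using \<A>(1) \<kappa> by (intro countable_UN) auto
    moreover have "\<forall>K\<in>\<Union>(\<kappa> ` \<A>). compactin X K" using \<kappa> by auto
    moreover have "\<Union>\<A> \<subseteq> \<Union>(\<Union>(\<kappa> ` \<A>))"
    proof
      fix x assume "x \<in> \<Union>\<A>"
      then obtain A where A: "A \<in> \<A>" "x \<in> A" by blast
      with \<kappa> have "A \<subseteq> \<Union>(\<kappa> A)" by simp
      with A show "x \<in> \<Union>(\<Union>(\<kappa> ` \<A>))" by blast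
    qed
    ultimately show "\<Union>\<A> \<in> ?\<I>"
      by (intro CollectI exI[of _ "\<Union>(\<kappa> ` \<A>)"] conjI)
  qed
  then obtain A where A: "A \<in> ?\<I>" "S \<subseteq> A" ..
  from A(1) obtain \<K> where \<K>: "countable \<K>" "\<forall>K\<in>\<K>. compactin X K" "A \<subseteq> \<Union>\<K>"
    unfolding mem_Collect_eq by (elim exE conjE)
  have "\<Union>\<K> = S"
    using \<K>(2,3) A(2) compactin_subset_topspace unfolding S_def by fast
  then show ?thesis
    using \<K>(1,2) unfolding sigma_compact_space_def S_def by blast
qed

theorem theorem6p1:
  fixes R :: "real set" and X :: "'a topology"
  assumes "characteristic_range_set R"
    and "ultrametrizable_space X"
  shows "sigma_compact_space X \<longleftrightarrow> completely_metrizable_space (UMet_bd_topology X R)"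
  using sigma_compact_imp_completely_metrizable[OF assms]
    completely_metrizable_imp_sigma_compact[OF assms] by blast

end
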